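(* Let $q \geq 2$ be an integer and let $\rho = \frac{2}{q+1}$. For each positive integer $r$ let $m = m(r) = \lfloor \rho^{-r} \rfloor$, $n = n(r) = mr$, and let $f = f_r\colon [q]^n \to [q]$ be the generalized tribes function with $m$ blocks of size $r$. Then each $f_r$ is symmetric and monotone, and there exist constants $0 < c \le C$ depending only on $q$ such that for every $0 < \varepsilon < 1/2$, for all sufficiently large $r$ (depending on $q$ and $\varepsilon$) and for every $a \in [q]$, $$c\,\frac{\log((1-\varepsilon)/\varepsilon)}{\log n} \;\leq\; \gamma\left(\left\{\mu \in \Delta[q] \;\middle|\; \varepsilon \leq \mathbb{P}_{x\sim\mu^{\otimes n}}[f_r(x)=a]\leq 1-\varepsilon\right\}\right) \;\leq\; C\,\frac{\log((1-\varepsilon)/\varepsilon)}{\log n}.$$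
   Context: $[q] = \{0,1,\ldots,q-1\}$ and $\log$ is the base-2 logarithm. $\Delta[q]$ is the simplex of probability measures on $[q]$, and $\gamma$ is the Lebesgue measure on $\Delta[q]$ normalized so that $\gamma(\Delta[q])=1$. $\mu^{\otimes n}$ is the product measure on $[q]^n$. Generalized tribes function: partition $\{1,\ldots,n\}$, $n=mr$, into disjoint sets $T_1,\ldots,T_m$ of equal size $r$. For $a \in [q]$ and $x \in [q]^n$ let $$N_a(x)=\#\{i\in\{1,\ldots,m\} \mid x_j=a\text{ for all }j\in T_i\},$$ and set $f_r(x)=\min\arg\max_{a\in[q]} N_a(x)$, i.e. the smallest element (in the order $0<1<\cdots<q-1$) among those $a\in[q]$ maximizing $N_a(x)$. For $a \in [q]$ and $x,y \in [q]^n$, write $x \leq_a y$ if $\{i \mid x_i = a\} \subseteq \{i \mid y_i = a\}$ and $x_i = y_i$ for every $i$ with $y_i \neq a$. A function $f\colon [q]^n \to [q]$ is monotone if for all $a \in [q]$ and all $x \leq_a y$, $f(x)=a$ implies $f(y)=a$. It is symmetric if there is a transitive subgroup $\Sigma$ of the group of permutations of $\{1,\ldots,n\}$ such that $f(x_\sigma)=f(x)$ for all $x\in[q]^n$, $\sigma\in\Sigma$, where $(x_\sigma)_i = x_{\sigma(i)}$. *)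

theory Defs
  imports "HOL-Probability.Probability" "HOL-Algebra.Sym_Groups"
begin

text \<open>
  The alphabet \<open>[q]\<close> is \<open>{..<q}\<close> and \<open>[q]\<^sup>n\<close> is \<open>{1..n} \<rightarrow>\<^sub>E {..<q}\<close>.
\<close>

abbreviation words :: "nat \<Rightarrow> nat \<Rightarrow> (nat \<Rightarrow> nat) set" where
  "words q n \<equiv> {1..n} \<rightarrow>\<^sub>E {..<q}"


section \<open>Probability measures on the alphabet\<close>

text \<open>A probability measure on \<open>[q]\<close> is represented by its vector of point masses.\<close>

definition prob_simplex :: "nat \<Rightarrow> (nat \<Rightarrow> real) set" where
  "prob_simplex q =
     {\<mu> \<in> {..<q} \<rightarrow>\<^sub>E UNIV. (\<forall>a<q. 0 \<le> \<mu> a) \<and> (\<Sum>a<q. \<mu> a) = 1}"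

definition product_dist :: "nat \<Rightarrow> nat \<Rightarrow> (nat \<Rightarrow> real) \<Rightarrow> (nat \<Rightarrow> nat) measure" where
  "product_dist q n \<mu> =
     (\<Pi>\<^sub>M i\<in>{1..n}. point_measure {..<q} (\<lambda>a. ennreal (\<mu> a)))"

lemma prob_space_product_dist:
  assumes "\<mu> \<in> prob_simplex q"
  shows "prob_space (product_dist q n \<mu>)"
proof -
  have "(\<Sum>a<q. ennreal (\<mu> a)) = ennreal (\<Sum>a<q. \<mu> a)"
    by (rule sum_ennreal) (use assms in \<open>auto simp: prob_simplex_def\<close>)
  also have "\<dots> = 1"
    using assms by (simp add: prob_simplex_def)
  finally show ?thesis
    unfolding product_dist_def by (intro prob_space_PiM prob_space_point_measure) auto
qed

text \<open>
  The simplex lies in a hyperplane of \<open>\<real>\<^sup>q\<close>, where \<open>q\<close>-dimensional Lebesgue measure vanishes.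
  Dropping the last coordinate maps it affinely and bijectively onto the corner simplex in
  \<open>\<real>\<^sup>q\<^sup>-\<^sup>1\<close> (the inverse is \<open>add_last_coord\<close>), and affine bijections preserve Lebesgue
  measure up to a constant factor. Hence the normalized Lebesgue measure on the simplex is the
  push-forward of the normalized Lebesgue measure on the corner simplex. It is represented as a
  measure on \<open>\<real>\<^sup>q\<close> that is concentrated on \<open>prob_simplex q\<close>.
\<close>

definition corner_simplex :: "nat \<Rightarrow> (nat \<Rightarrow> real) set" where
  "corner_simplex d = {x \<in> {..<d} \<rightarrow>\<^sub>E UNIV. (\<forall>a<d. 0 \<le> x a) \<and> (\<Sum>a<d. x a) \<le> 1}"

definition add_last_coord :: "nat \<Rightarrow> (nat \<Rightarrow> real) \<Rightarrow> nat \<Rightarrow> real" where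
  "add_last_coord q x = (\<lambda>a\<in>{..<q}. if a < q - 1 then x a else 1 - (\<Sum>b<q - 1. x b))"

definition simplex_measure :: "nat \<Rightarrow> (nat \<Rightarrow> real) measure" where
  "simplex_measure q =
     distr (uniform_measure (\<Pi>\<^sub>M a\<in>{..<q - 1}. lborel) (corner_simplex (q - 1)))
       (\<Pi>\<^sub>M a\<in>{..<q}. borel) (add_last_coord q)"

lemma bij_betw_add_last_coord:
  assumes "q \<ge> 1"
  shows "bij_betw (add_last_coord q) (corner_simplex (q - 1)) (prob_simplex q)"
proof (rule bij_betw_byWitness[where f' = "\<lambda>\<mu>. restrict \<mu> {..<q - 1}"])
  obtain d where q: "q = Suc d" using assms by (cases q) auto
  show "\<forall>x\<in>corner_simplex (q - 1). restrict (add_last_coord q x) {..<q - 1} = x"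
    by (auto simp: q corner_simplex_def add_last_coord_def fun_eq_iff PiE_def extensional_def)
  show "\<forall>\<mu>\<in>prob_simplex q. add_last_coord q (restrict \<mu> {..<q - 1}) = \<mu>"
    by (auto simp: q prob_simplex_def add_last_coord_def fun_eq_iff PiE_def extensional_def
        less_Suc_eq)
  show "add_last_coord q ` corner_simplex (q - 1) \<subseteq> prob_simplex q"
    by (auto simp: q prob_simplex_def corner_simplex_def add_last_coord_def)
  show "(\<lambda>\<mu>. restrict \<mu> {..<q - 1}) ` prob_simplex q \<subseteq> corner_simplex (q - 1)"
    by (auto simp: q prob_simplex_def corner_simplex_def)
qed

lemma emeasure_corner_simplex:
  "emeasure (\<Pi>\<^sub>M a\<in>{..<d}. lborel) (corner_simplex d) = ennreal (1 / fact d)"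
proof -
  have "corner_simplex d =
      {x. (\<forall>i\<in>{..<d}. 0 \<le> x i) \<and> sum x {..<d} \<le> 1} \<inter> space (\<Pi>\<^sub>M a\<in>{..<d}. lborel)"
    by (auto simp: corner_simplex_def space_PiM)
  then show ?thesis
    using emeasure_std_simplex_aux[of "{..<d}" 1] by simp
qed

lemma measurable_add_last_coord:
  "add_last_coord q \<in> (\<Pi>\<^sub>M a\<in>{..<q - 1}. lborel) \<rightarrow>\<^sub>M (\<Pi>\<^sub>M a\<in>{..<q}. borel)"
  unfolding add_last_coord_def
proof (rule measurable_restrict)
  fix a assume "a \<in> {..<q}"
  show "(\<lambda>x. if a < q - 1 then x a else 1 - (\<Sum>b<q - 1. x b))
      \<in> (\<Pi>\<^sub>M a\<in>{..<q - 1}. lborel) \<rightarrow>\<^sub>M borel"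
  proof (cases "a < q - 1")
    case True
    then have "(\<lambda>x. x a) \<in> (\<Pi>\<^sub>M a\<in>{..<q - 1}. lborel) \<rightarrow>\<^sub>M (lborel :: real measure)"
      by (intro measurable_component_singleton) simp
    with True show ?thesis by simp
  next
    case False
    have "(\<lambda>x. x b) \<in> (\<Pi>\<^sub>M a\<in>{..<q - 1}. lborel) \<rightarrow>\<^sub>M (borel :: real measure)"
      if "b < q - 1" for b
    proof -
      have "(\<lambda>x. x b) \<in> (\<Pi>\<^sub>M a\<in>{..<q - 1}. lborel) \<rightarrow>\<^sub>M (lborel :: real measure)"
        using that by (intro measurable_component_singleton) simp
      then show ?thesis by simp
    qed
    with False show ?thesis by (auto intro!: borel_measurable_diff borel_measurable_sum)
  qed
qed

lemma prob_space_simplex_measure: "prob_space (simplex_measure q)"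
proof -
  have "prob_space (uniform_measure (\<Pi>\<^sub>M a\<in>{..<q - 1}. lborel) (corner_simplex (q - 1)))"
    by (rule prob_space_uniform_measure) (auto simp: emeasure_corner_simplex)
  then show ?thesis
    unfolding simplex_measure_def
    by (rule prob_space.prob_space_distr) (use measurable_add_last_coord in simp)
qed

lemma measure_simplex_measure_prob_simplex:
  assumes "q \<ge> 1"
  shows "measure (simplex_measure q) (prob_simplex q) = 1"
proof -
  let ?L = "\<Pi>\<^sub>M a\<in>{..<q - 1}. (lborel :: real measure)"
  let ?U = "uniform_measure ?L (corner_simplex (q - 1))"
  interpret U: prob_space ?U
    by (rule prob_space_uniform_measure) (auto simp: emeasure_corner_simplex)
  have "prob_simplex q = {\<mu> \<in> space (\<Pi>\<^sub>M a\<in>{..<q}. borel).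
      (\<forall>a\<in>{..<q}. 0 \<le> \<mu> a) \<and> (\<Sum>a<q. \<mu> a) = 1}"
    by (auto simp: prob_simplex_def space_PiM)
  also have "\<dots> \<in> sets (\<Pi>\<^sub>M a\<in>{..<q}. borel)"
    by measurable
  finally have meas: "prob_simplex q \<in> sets (\<Pi>\<^sub>M a\<in>{..<q}. borel)" .
  have corner: "corner_simplex (q - 1) \<in> sets ?L"
    by (rule ccontr) (use emeasure_corner_simplex[of "q - 1"] in \<open>auto simp: emeasure_notin_sets\<close>)
  have "add_last_coord q -` prob_simplex q \<inter> space ?L \<in> sets ?L"
    using measurable_sets[OF measurable_add_last_coord meas] by simp
  moreover have "corner_simplex (q - 1) \<subseteq> add_last_coord q -` prob_simplex q \<inter> space ?L"
    using bij_betw_add_last_coord[OF assms] sets.sets_into_space[OF corner]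
    by (auto simp: bij_betw_def)
  moreover have "U.prob (corner_simplex (q - 1)) = 1"
    using corner by (simp add: measure_def emeasure_corner_simplex divide_ennreal)
  ultimately have "U.prob (add_last_coord q -` prob_simplex q \<inter> space ?L) \<ge> 1"
    using U.finite_measure_mono[of "corner_simplex (q - 1)"
        "add_last_coord q -` prob_simplex q \<inter> space ?L"] by simp
  then show ?thesis
    unfolding simplex_measure_def
    by (subst measure_distr)
      (use measurable_add_last_coord meas U.prob_le_1 in \<open>auto intro: antisym\<close>)
qed


section \<open>Symmetric and monotone functions\<close>

definition le_at :: "nat \<Rightarrow> nat \<Rightarrow> (nat \<Rightarrow> nat) \<Rightarrow> (nat \<Rightarrow> nat) \<Rightarrow> bool" where
  "le_at n a x y \<longleftrightarrow>
     {i \<in> {1..n}. x i = a} \<subseteq> {i \<in> {1..n}. y i = a} \<and> (\<forall>i\<in>{1..n}. y i \<noteq> a \<longrightarrow> x i = y i)"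

definition monotone_fun :: "nat \<Rightarrow> nat \<Rightarrow> ((nat \<Rightarrow> nat) \<Rightarrow> nat) \<Rightarrow> bool" where
  "monotone_fun q n f \<longleftrightarrow>
     (\<forall>a<q. \<forall>x\<in>words q n. \<forall>y\<in>words q n. le_at n a x y \<longrightarrow> f x = a \<longrightarrow> f y = a)"

text \<open>
  A permutation of \<open>{1..n}\<close> is the identity elsewhere, so \<open>x \<circ> \<sigma>\<close> is again an element of
  \<open>words q n\<close>.
\<close>

definition symmetric_fun :: "nat \<Rightarrow> nat \<Rightarrow> ((nat \<Rightarrow> nat) \<Rightarrow> nat) \<Rightarrow> bool" where
  "symmetric_fun q n f \<longleftrightarrow>
     (\<exists>\<Sigma>. subgroup \<Sigma> (sym_group n) \<and>
          (\<forall>i\<in>{1..n}. \<forall>j\<in>{1..n}. \<exists>\<sigma>\<in>\<Sigma>. \<sigma> i = j) \<and>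
          (\<forall>x\<in>words q n. \<forall>\<sigma>\<in>\<Sigma>. f (x \<circ> \<sigma>) = f x))"


section \<open>Generalized tribes functions\<close>

definition tribes_partition :: "nat \<Rightarrow> nat \<Rightarrow> (nat \<Rightarrow> nat set) \<Rightarrow> bool" where
  "tribes_partition m r T \<longleftrightarrow>
     (\<Union>i\<in>{1..m}. T i) = {1..m * r} \<and> disjoint_family_on T {1..m} \<and> (\<forall>i\<in>{1..m}. card (T i) = r)"

definition unanimous_tribes :: "nat \<Rightarrow> (nat \<Rightarrow> nat set) \<Rightarrow> nat \<Rightarrow> (nat \<Rightarrow> nat) \<Rightarrow> nat" where
  "unanimous_tribes m T a x = card {i \<in> {1..m}. \<forall>j\<in>T i. x j = a}"

definition gen_tribes :: "nat \<Rightarrow> nat \<Rightarrow> (nat \<Rightarrow> nat set) \<Rightarrow> (nat \<Rightarrow> nat) \<Rightarrow> nat" where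
  "gen_tribes q m T x =
     Min {a. is_arg_max (\<lambda>a. unanimous_tribes m T a x) (\<lambda>a. a \<in> {..<q}) a}"

lemma gen_tribes_less:
  assumes "q \<ge> 1"
  shows "gen_tribes q m T x < q"
proof -
  let ?A = "{a. is_arg_max (\<lambda>a. unanimous_tribes m T a x) (\<lambda>a. a \<in> {..<q}) a}"
  have "finite ?A"
    by (rule finite_subset[of _ "{..<q}"]) (auto simp: is_arg_max_def)
  moreover obtain a
    where "a < q" "unanimous_tribes m T a x = Max ((\<lambda>a. unanimous_tribes m T a x) ` {..<q})"
    using Max_in[of "(\<lambda>a. unanimous_tribes m T a x) ` {..<q}"] assms
    by (fastforce simp: lessThan_empty_iff)
  then have "a \<in> ?A"
    by (auto simp: is_arg_max_def not_less intro!: Max_ge)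
  ultimately have "gen_tribes q m T x \<in> ?A"
    unfolding gen_tribes_def by (intro Min_in) auto
  then show ?thesis
    by (simp add: is_arg_max_def)
qed

definition tribes_rho :: "nat \<Rightarrow> real" where
  "tribes_rho q = 2 / (real q + 1)"

definition tribes_m :: "nat \<Rightarrow> nat \<Rightarrow> nat" where
  "tribes_m q r = nat \<lfloor>tribes_rho q powi (- int r)\<rfloor>"

definition tribes_n :: "nat \<Rightarrow> nat \<Rightarrow> nat" where
  "tribes_n q r = tribes_m q r * r"

end

theory Submission
  imports Defs "HOL-Real_Asymp.Real_Asymp"
begin

text \<open>
  A block is unanimous for the letter \<open>a\<close> with probability \<open>\<mu> a\<close> to the power \<open>r\<close>, and there are about
  \<open>\<rho>\<close> to the power \<open>-r\<close> blocks. The expected number of unanimous blocks for \<open>a\<close> is thus about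
  \<open>(\<mu> a / \<rho>)\<close> to the power \<open>r\<close>: tiny for \<open>\<mu> a < \<rho>\<close>, huge for \<open>\<mu> a > \<rho>\<close>. With
  high probability, if some letter exceeds \<open>\<rho>\<close>, the most likely letter wins; if none does, all
  counts vanish and \<open>0\<close> wins by default. The outcome is random only near the walls between these
  regions.

  At a wall \<open>\<mu> b = \<rho>\<close> with all other letters below \<open>\<rho>\<close>, put \<open>\<mu> b = \<rho> exp (s / r)\<close>. Then \<open>b\<close> has
  asymptotically no unanimous block with probability \<open>exp (- exp s)\<close> (\<open>no_votes_tendsto\<close>), and it
  wins otherwise if \<open>b \<noteq> 0\<close>. The undecided values of \<open>s\<close> form an interval whose length is
  comparable to the log-odds \<open>ln ((1 - \<epsilon>) / \<epsilon>)\<close> (\<open>gumbel_length_le\<close>, \<open>gumbel_length_ge\<close>), so the wall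
  contributes a slab of thickness of order \<open>ln ((1 - \<epsilon>) / \<epsilon>) / r\<close>, and \<open>r\<close> is comparable to \<open>ln n\<close>.

  Upper bound (\<open>decided_outside_exceptional\<close>, \<open>measure_exceptional_le\<close>): at a wall \<open>\<mu> b = \<mu> c\<close>
  above \<open>\<rho>\<close> both counts are exponentially large, so by a Chernoff bound (\<open>word_exp_overtake_le\<close>) the
  outcome is decided outside a slab of thickness \<open>o(1 / r)\<close>; and points where two letters are
  both near \<open>\<rho>\<close> lie in a set of codimension two, which is negligible as well. Lower bound
  (\<open>single_contender_undecided\<close>, \<open>measure_single_contender_ge\<close>): as \<open>\<rho> = 2 / (q + 1)\<close>, a letter
  at \<open>\<rho>\<close> leaves \<open>\<rho> / 2\<close> on average to each of the other letters, so every wall \<open>\<mu> b = \<rho>\<close> has a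
  part of positive area on which all other letters stay below \<open>\<rho>\<close>.

  Monotonicity and symmetry hold for every block size: only the vote counts enter, and the permutations
  that map blocks to blocks act transitively on the coordinates.

  The probabilities come from a single identity, the joint generating function of two vote counts
  (\<open>word_exp_two_votes\<close>), and the volumes from slicing the simplex along one direction.
\<close>


section \<open>Monotonicity and symmetry\<close>

text \<open>
  Only vote counts enter: ties are broken towards the smaller letter, so the winner must beat smaller
  letters strictly and larger letters weakly.
\<close>

lemma gen_tribes_eq_iff:
  assumes "q \<ge> 1"
  shows "gen_tribes q m T x = a \<longleftrightarrow> a < q \<and>
    (\<forall>b<q. unanimous_tribes m T b x \<le> unanimous_tribes m T a x) \<and>
    (\<forall>b<a. unanimous_tribes m T b x < unanimous_tribes m T a x)"
    (is "_ \<longleftrightarrow> ?R a")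
proof -
  let ?N = "\<lambda>a. unanimous_tribes m T a x"
  let ?A = "{a. is_arg_max ?N (\<lambda>a. a \<in> {..<q}) a}"
  have A: "?A = {a. a < q \<and> (\<forall>b<q. ?N b \<le> ?N a)}"
    by (auto simp: is_arg_max_def not_less simp flip: not_le)
  have fin: "finite ?A"
    by (rule finite_subset[of _ "{..<q}"]) (auto simp: is_arg_max_def)
  have "Max (?N ` {..<q}) \<in> ?N ` {..<q}"
    using assms by (intro Max_in) (auto simp: lessThan_empty_iff)
  then obtain b where "b < q" "?N b = Max (?N ` {..<q})" by auto
  then have "b \<in> ?A" unfolding A by (auto intro!: Max_ge)
  then have "?A \<noteq> {}" by blast
  then have min: "gen_tribes q m T x = a \<longleftrightarrow> a \<in> ?A \<and> (\<forall>b\<in>?A. a \<le> b)" for a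
    unfolding gen_tribes_def using fin by (subst eq_Min_iff[symmetric]) auto
  show ?thesis
  proof
    assume "gen_tribes q m T x = a"
    then have "a \<in> ?A" and *: "\<forall>b\<in>?A. a \<le> b"
      unfolding min by blast+
    then have a: "a < q" "\<And>b. b < q \<Longrightarrow> ?N b \<le> ?N a"
      unfolding A by blast+
    have "?N b < ?N a" if "b < a" for b
    proof (rule ccontr)
      assume "\<not> ?thesis"
      with a that have "b \<in> ?A" unfolding A by (auto simp: not_less intro: order.trans)
      with * that show False by (meson not_le)
    qed
    with a show "?R a" by blast
  next
    assume R: "?R a"
    then have "a \<le> b" if "b \<in> ?A" for b
      using that unfolding A by (metis (mono_tags, lifting) mem_Collect_eq not_le)
    with R show "gen_tribes q m T x = a" unfolding min A by blast
  qed
qed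

text \<open>
  Changing some coordinates to \<open>a\<close> can only create unanimous blocks for \<open>a\<close> and destroy those of
  other letters.
\<close>

lemma monotone_gen_tribes:
  assumes "q \<ge> 1" "(\<Union>i\<in>{1..m}. T i) \<subseteq> {1..n}"
  shows "monotone_fun q n (gen_tribes q m T)"
  unfolding monotone_fun_def
proof (intro allI impI ballI)
  fix a x y assume le: "le_at n a x y" and fx: "gen_tribes q m T x = a"
  have sub: "j \<in> {1..n}" if "i \<in> {1..m}" "j \<in> T i" for i j
    using assms(2) that by blast
  have xa: "y j = a" if "i \<in> {1..m}" "j \<in> T i" "x j = a" for i j
    using le sub[OF that(1,2)] that(3) unfolding le_at_def by blast
  have yb: "x j = y j" if "i \<in> {1..m}" "j \<in> T i" "y j \<noteq> a" for i j
    using le sub[OF that(1,2)] that(3) unfolding le_at_def by blast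
  have up: "unanimous_tribes m T a x \<le> unanimous_tribes m T a y"
    unfolding unanimous_tribes_def using xa by (intro card_mono) auto
  have down: "unanimous_tribes m T b y \<le> unanimous_tribes m T b x" if "b \<noteq> a" for b
    unfolding unanimous_tribes_def using yb that by (intro card_mono) auto
  note * = fx[unfolded gen_tribes_eq_iff[OF assms(1)]]
  show "gen_tribes q m T y = a"
    unfolding gen_tribes_eq_iff[OF assms(1)]
  proof (intro conjI allI impI)
    show "a < q" using * by simp
    show "unanimous_tribes m T b y \<le> unanimous_tribes m T a y" if "b < q" for b
      using * up down[of b] that by (cases "b = a") (auto intro: order.trans)
    show "unanimous_tribes m T b y < unanimous_tribes m T a y" if "b < a" for b
    proof -
      have "unanimous_tribes m T b x < unanimous_tribes m T a x" using * that by blast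
      with up down[of b] that show ?thesis by linarith
    qed
  qed
qed

lemma tribes_partition_inj_on:
  assumes "tribes_partition m r T" "r \<ge> 1"
  shows "inj_on T {1..m}"
proof (rule inj_onI, rule ccontr)
  fix i j assume ij: "i \<in> {1..m}" "j \<in> {1..m}" "T i = T j" "i \<noteq> j"
  then have "T i \<inter> T j = {}"
    using assms(1) unfolding tribes_partition_def disjoint_family_on_def by blast
  moreover have "card (T i) = r"
    using assms ij by (auto simp: tribes_partition_def)
  ultimately show False using ij assms(2) by auto
qed

text \<open>
  Any permutation of the coordinates that maps blocks to blocks preserves the vote counts. These
  permutations act transitively, because all blocks have the same size: swap two blocks along any
  bijection, and then move points freely inside a block.
\<close>

lemma symmetric_gen_tribes:
  assumes part: "tribes_partition m r T" and r: "r \<ge> 1" and n: "n = m * r"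
  shows "symmetric_fun q n (gen_tribes q m T)"
proof -
  define \<T> where "\<T> = T ` {1..m}"
  define \<Sigma> where "\<Sigma> = {\<sigma>. \<sigma> permutes {1..n} \<and> image \<sigma> ` \<T> = \<T>}"
  have inj: "inj_on T {1..m}" by (rule tribes_partition_inj_on[OF part r])
  have union: "\<Union>\<T> = {1..n}" and card: "\<And>B. B \<in> \<T> \<Longrightarrow> card B = r"
    using part by (auto simp: \<T>_def n tribes_partition_def)
  have disj: "A \<inter> B = {}" if "A \<in> \<T>" "B \<in> \<T>" "A \<noteq> B" for A B
    using part that unfolding \<T>_def tribes_partition_def disjoint_family_on_def by fast
  have comp: "\<sigma> \<circ> \<tau> \<in> \<Sigma>" if "\<sigma> \<in> \<Sigma>" "\<tau> \<in> \<Sigma>" for \<sigma> \<tau>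
  proof -
    have "image (\<sigma> \<circ> \<tau>) ` \<T> = image \<sigma> ` image \<tau> ` \<T>" by (simp add: image_image image_comp)
    then show ?thesis using that by (simp add: \<Sigma>_def permutes_compose)
  qed
  \<comment> \<open>Both the swaps of two points and the swaps of two blocks are involutions, for which mapping
    blocks to blocks already gives equality of the two families.\<close>
  have involution: "\<sigma> \<in> \<Sigma>" if "\<sigma> permutes {1..n}" "\<And>B. B \<in> \<T> \<Longrightarrow> \<sigma> ` B \<in> \<T>" "\<And>x. \<sigma> (\<sigma> x) = x" for \<sigma>
  proof -
    have "B \<in> image \<sigma> ` \<T>" if "B \<in> \<T>" for B
    proof -
      have "B = \<sigma> ` (\<sigma> ` B)" using \<open>\<And>x. \<sigma> (\<sigma> x) = x\<close> by (simp add: image_image)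
      then show ?thesis using \<open>\<And>B. B \<in> \<T> \<Longrightarrow> \<sigma> ` B \<in> \<T>\<close>[OF that] by blast
    qed
    with that show ?thesis by (auto simp: \<Sigma>_def)
  qed
  have "subgroup \<Sigma> (sym_group n)"
  proof
    show "\<Sigma> \<subseteq> carrier (sym_group n)" by (auto simp: \<Sigma>_def sym_group_carrier)
    show "\<sigma> \<otimes>\<^bsub>sym_group n\<^esub> \<tau> \<in> \<Sigma>" if "\<sigma> \<in> \<Sigma>" "\<tau> \<in> \<Sigma>" for \<sigma> \<tau>
      using comp that by (simp add: sym_group_mult)
    show "\<one>\<^bsub>sym_group n\<^esub> \<in> \<Sigma>" by (simp add: sym_group_one \<Sigma>_def permutes_id)
    fix \<sigma> assume \<sigma>: "\<sigma> \<in> \<Sigma>"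
    then have p: "\<sigma> permutes {1..n}" by (simp add: \<Sigma>_def)
    have "image (inv' \<sigma>) ` \<T> = image (inv' \<sigma>) ` image \<sigma> ` \<T>" using \<sigma> by (simp add: \<Sigma>_def)
    also have "\<dots> = \<T>" by (simp add: image_image permutes_inverses[OF p])
    finally have "inv' \<sigma> \<in> \<Sigma>" using permutes_inv[OF p] by (simp add: \<Sigma>_def)
    then show "inv\<^bsub>sym_group n\<^esub> \<sigma> \<in> \<Sigma>"
      using p by (simp add: sym_group_carrier)
  qed
  moreover have "\<exists>\<sigma>\<in>\<Sigma>. \<sigma> i = j" if ij: "i \<in> {1..n}" "j \<in> {1..n}" for i j
  proof -
    have inside: "\<exists>\<sigma>\<in>\<Sigma>. \<sigma> i = j" if "A \<in> \<T>" "i \<in> A" "j \<in> A" for A i j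
    proof -
      have "Transposition.transpose i j ` B = B" if B: "B \<in> \<T>" for B
      proof (cases "A = B")
        case True
        with \<open>i \<in> A\<close> \<open>j \<in> A\<close> show ?thesis by simp
      next
        case False
        with disj[OF \<open>A \<in> \<T>\<close> B] \<open>i \<in> A\<close> \<open>j \<in> A\<close> have "i \<notin> B" "j \<notin> B" by auto
        then show ?thesis by simp
      qed
      moreover have "Transposition.transpose i j permutes {1..n}"
        using that union by (intro permutes_swap_id) auto
      ultimately have "Transposition.transpose i j \<in> \<Sigma>"
        by (intro involution) simp_all
      then show ?thesis by (intro bexI[of _ "Transposition.transpose i j"]) auto
    qed
    obtain A B where AB: "A \<in> \<T>" "i \<in> A" "B \<in> \<T>" "j \<in> B" using ij union by (metis UnionE)
    show ?thesis
    proof (cases "A = B")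
      case True
      with inside AB show ?thesis by blast
    next
      case False
      with disj AB have AB0: "A \<inter> B = {}" by auto
      have fin: "finite A" "finite B"
        using card AB r by (metis card.infinite not_one_le_zero)+
      with card AB have "\<exists>g. bij_betw g A B" by (intro finite_same_card_bij) auto
      then obtain g where g: "bij_betw g A B" ..
      define h where "h = inv_into A g"
      define \<sigma> where "\<sigma> x = (if x \<in> A then g x else if x \<in> B then h x else x)" for x
      have h: "bij_betw h B A" unfolding h_def by (rule bij_betw_inv_into[OF g])
      have gh: "g x \<in> B" "h (g x) = x" if "x \<in> A" for x
        using g that by (auto simp: h_def bij_betw_def)
      have hg: "h x \<in> A" "g (h x) = x" if "x \<in> B" for x
        using h that by (auto simp: h_def bij_betw_def f_inv_into_f bij_betw_inv_into_right[OF g that])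
      have inv: "\<sigma> (\<sigma> x) = x" for x
        using gh hg AB0 by (auto simp: \<sigma>_def)
      have "\<sigma> permutes {1..n}"
      proof -
        have "A \<subseteq> {1..n}" "B \<subseteq> {1..n}" using AB union by auto
        then have "\<sigma> x = x" if "x \<notin> {1..n}" for x
          using that by (auto simp: \<sigma>_def)
        then show ?thesis using inv unfolding permutes_def by metis
      qed
      moreover have "\<sigma> ` D \<in> \<T>" if D: "D \<in> \<T>" for D
      proof -
        consider "D = A" | "D = B" | "D \<noteq> A" "D \<noteq> B" by auto
        then show ?thesis
        proof cases
          case 1
          have "\<sigma> ` A = g ` A" by (auto simp: \<sigma>_def)
          with 1 g AB show ?thesis by (simp add: bij_betw_def)
        next
          case 2
          have "\<sigma> ` B = h ` B" using AB0 by (intro image_cong) (auto simp: \<sigma>_def)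
          with 2 h AB show ?thesis by (simp add: bij_betw_def)
        next
          case 3
          then have "D \<inter> A = {}" "D \<inter> B = {}" using disj D AB by auto
          then have "\<sigma> ` D = id ` D" by (intro image_cong) (auto simp: \<sigma>_def)
          with D show ?thesis by simp
        qed
      qed
      ultimately have "\<sigma> \<in> \<Sigma>" using inv by (rule involution)
      moreover have "\<sigma> i \<in> B" using AB gh by (simp add: \<sigma>_def)
      then obtain \<tau> where "\<tau> \<in> \<Sigma>" "\<tau> (\<sigma> i) = j" using inside AB by blast
      ultimately show ?thesis using comp by (intro bexI[of _ "\<tau> \<circ> \<sigma>"]) auto
    qed
  qed
  moreover have "gen_tribes q m T (x \<circ> \<sigma>) = gen_tribes q m T x" if \<sigma>: "\<sigma> \<in> \<Sigma>" for x \<sigma>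
  proof -
    have p: "\<sigma> permutes {1..n}" and blocks: "image \<sigma> ` \<T> = \<T>" using \<sigma> by (auto simp: \<Sigma>_def)
    have N: "unanimous_tribes m T a y = card {B\<in>\<T>. \<forall>j\<in>B. y j = a}" for a y
    proof -
      have "{B\<in>\<T>. \<forall>j\<in>B. y j = a} = T ` {i\<in>{1..m}. \<forall>j\<in>T i. y j = a}" by (auto simp: \<T>_def)
      moreover have "inj_on T {i\<in>{1..m}. \<forall>j\<in>T i. y j = a}" by (rule inj_on_subset[OF inj]) auto
      ultimately show ?thesis by (simp add: unanimous_tribes_def card_image)
    qed
    have "unanimous_tribes m T a (x \<circ> \<sigma>) = unanimous_tribes m T a x" for a
    proof -
      have "{B\<in>\<T>. \<forall>j\<in>B. x j = a} = image \<sigma> ` {B\<in>\<T>. \<forall>j\<in>B. (x \<circ> \<sigma>) j = a}"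
      proof (intro equalityI subsetI)
        fix B assume B: "B \<in> {B\<in>\<T>. \<forall>j\<in>B. x j = a}"
        then obtain D where "D \<in> \<T>" "B = \<sigma> ` D" using blocks by blast
        with B show "B \<in> image \<sigma> ` {B\<in>\<T>. \<forall>j\<in>B. (x \<circ> \<sigma>) j = a}" by auto
      next
        fix B assume "B \<in> image \<sigma> ` {B\<in>\<T>. \<forall>j\<in>B. (x \<circ> \<sigma>) j = a}"
        then obtain D where D: "D \<in> \<T>" "\<forall>j\<in>D. x (\<sigma> j) = a" "B = \<sigma> ` D" by auto
        moreover have "\<sigma> ` D \<in> \<T>" using blocks D(1) by blast
        ultimately show "B \<in> {B\<in>\<T>. \<forall>j\<in>B. x j = a}" by auto
      qed
      moreover have "inj_on (image \<sigma>) X" for X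
        using permutes_inj[OF p] by (simp add: inj_on_def inj_image_eq_iff)
      ultimately show ?thesis
        by (simp only: N card_image)
    qed
    then show ?thesis unfolding gen_tribes_def by simp
  qed
  ultimately show ?thesis unfolding symmetric_fun_def by (intro exI[of _ \<Sigma>] conjI) auto
qed


section \<open>Expectations over random words\<close>

text \<open>
  The expectation under the product measure as a finite sum. This form is a polynomial in the point
  masses, and it is defined for every vector \<open>\<mu>\<close>, so measurability in \<open>\<mu>\<close> is immediate.
\<close>

definition word_exp :: "nat \<Rightarrow> nat \<Rightarrow> (nat \<Rightarrow> real) \<Rightarrow> ((nat \<Rightarrow> nat) \<Rightarrow> real) \<Rightarrow> real" where
  "word_exp q n \<mu> g = (\<Sum>x\<in>words q n. (\<Prod>i=1..n. \<mu> (x i)) * g x)"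

lemma prob_product_dist:
  assumes "\<mu> \<in> prob_simplex q"
  shows "\<P>(x in product_dist q n \<mu>. P x) = word_exp q n \<mu> (\<lambda>x. of_bool (P x))"
proof -
  let ?p = "point_measure {..<q} (\<lambda>a. ennreal (\<mu> a))"
  have nonneg: "\<And>a. a < q \<Longrightarrow> 0 \<le> \<mu> a" using assms by (auto simp: prob_simplex_def)
  have "prob_space ?p"
  proof (rule prob_space_point_measure)
    have "(\<Sum>a<q. ennreal (\<mu> a)) = ennreal (\<Sum>a<q. \<mu> a)"
      by (rule sum_ennreal) (use nonneg in auto)
    then show "(\<Sum>a<q. ennreal (\<mu> a)) = 1" using assms by (simp add: prob_simplex_def)
  qed (auto simp: nonneg)
  then interpret p: product_prob_space "\<lambda>_. ?p" "{1..n}"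
    by (simp add: product_prob_space_def product_prob_space_axioms_def product_sigma_finite_def
        prob_space_imp_sigma_finite)
  let ?M = "product_dist q n \<mu>"
  have space: "space ?M = words q n"
    by (simp add: product_dist_def space_PiM space_point_measure)
  have single: "{x} \<in> sets ?M \<and> emeasure ?M {x} = (\<Prod>i=1..n. ennreal (\<mu> (x i)))" if "x \<in> words q n" for x
  proof -
    have x: "x i \<in> {..<q}" if "i \<in> {1..n}" for i using \<open>x \<in> words q n\<close> that by (auto simp: PiE_iff)
    have eq: "{x} = Pi\<^sub>E {1..n} (\<lambda>i. {x i})"
      using \<open>x \<in> words q n\<close> by (intro PiE_singleton[symmetric]) (simp add: PiE_iff)
    have "Pi\<^sub>E {1..n} (\<lambda>i. {x i}) \<in> sets ?M"
      unfolding product_dist_def by (rule sets_PiM_I_finite) (use x in \<open>auto simp: sets_point_measure\<close>)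
    moreover have "emeasure ?M (Pi\<^sub>E {1..n} (\<lambda>i. {x i})) = (\<Prod>i=1..n. emeasure ?p {x i})"
      unfolding product_dist_def by (rule p.emeasure_PiM) (use x in \<open>auto simp: sets_point_measure\<close>)
    moreover have "\<dots> = (\<Prod>i=1..n. ennreal (\<mu> (x i)))"
      using x by (intro prod.cong) (auto simp: emeasure_point_measure_finite)
    ultimately show ?thesis by (simp add: eq)
  qed
  have fin: "finite (words q n)" by (intro finite_PiE) auto
  let ?A = "{x \<in> words q n. P x}"
  have "emeasure ?M ?A = (\<Sum>x\<in>?A. emeasure ?M {x})"
    using fin single by (intro emeasure_eq_sum_singleton) auto
  also have "\<dots> = (\<Sum>x\<in>?A. ennreal (\<Prod>i=1..n. \<mu> (x i)))"
  proof (intro sum.cong refl)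
    fix x assume "x \<in> ?A"
    then show "emeasure ?M {x} = ennreal (\<Prod>i=1..n. \<mu> (x i))"
      using single nonneg by (subst prod_ennreal[symmetric]) (auto simp: PiE_iff)
  qed
  also have "\<dots> = ennreal (\<Sum>x\<in>?A. \<Prod>i=1..n. \<mu> (x i))"
    by (rule sum_ennreal) (auto intro!: prod_nonneg nonneg simp: PiE_iff)
  finally have "measure ?M ?A = (\<Sum>x\<in>?A. \<Prod>i=1..n. \<mu> (x i))"
    unfolding measure_def by (simp, intro enn2real_ennreal sum_nonneg prod_nonneg)
      (auto intro!: nonneg simp: PiE_iff)
  also have "\<dots> = word_exp q n \<mu> (\<lambda>x. of_bool (P x))"
    unfolding word_exp_def using fin by (simp add: sum.inter_filter[symmetric] of_bool_def
        if_distrib[of "\<lambda>z. _ * z"] cong: if_cong)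
  finally show ?thesis by (simp add: space)
qed

lemma word_exp_add: "word_exp q n \<mu> (\<lambda>x. g x + h x) = word_exp q n \<mu> g + word_exp q n \<mu> h"
  by (simp add: word_exp_def algebra_simps sum.distrib)

lemma word_exp_diff: "word_exp q n \<mu> (\<lambda>x. g x - h x) = word_exp q n \<mu> g - word_exp q n \<mu> h"
  by (simp add: word_exp_def algebra_simps sum_subtractf)

lemma word_exp_sum: "word_exp q n \<mu> (\<lambda>x. \<Sum>c\<in>S. g c x) = (\<Sum>c\<in>S. word_exp q n \<mu> (g c))"
  unfolding word_exp_def sum_distrib_left by (rule sum.swap)

lemma word_exp_one:
  assumes "\<mu> \<in> prob_simplex q"
  shows "word_exp q n \<mu> (\<lambda>x. 1) = 1"
proof -
  have "word_exp q n \<mu> (\<lambda>x. 1) = (\<Prod>i=1..n. \<Sum>a<q. \<mu> a)"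
    unfolding word_exp_def by (subst prod_sum_PiE) auto
  then show ?thesis using assms by (simp add: prob_simplex_def)
qed

lemma word_exp_mono:
  assumes "\<mu> \<in> prob_simplex q" "\<And>x. x \<in> words q n \<Longrightarrow> g x \<le> h x"
  shows "word_exp q n \<mu> g \<le> word_exp q n \<mu> h"
  unfolding word_exp_def
  by (intro sum_mono mult_left_mono prod_nonneg assms(2))
    (use assms(1) in \<open>auto simp: prob_simplex_def PiE_iff\<close>)

text \<open>
  This is the independence of the blocks. Expanding the product over blocks chooses one term
  \<open>\<phi> j\<close> for each block \<open>j\<close>; each summand is then a product over single coordinates, which the
  product measure factorizes.
\<close>

lemma word_exp_prod_blocks:
  fixes w :: "'k \<Rightarrow> real"
  assumes K: "finite K" and part: "tribes_partition m r T"
  shows "word_exp q (m * r) \<mu> (\<lambda>x. \<Prod>j=1..m. \<Sum>k\<in>K. w k * (\<Prod>i\<in>T j. h k (x i)))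
    = (\<Sum>k\<in>K. w k * (\<Sum>v<q. \<mu> v * h k v) ^ r) ^ m"
proof -
  let ?n = "m * r" and ?\<Phi> = "{1..m} \<rightarrow>\<^sub>E K"
  let ?H = "\<lambda>k. \<Sum>v<q. \<mu> v * h k v"
  have union: "(\<Union>j\<in>{1..m}. T j) = {1..?n}" and card: "\<And>j. j \<in> {1..m} \<Longrightarrow> card (T j) = r"
    using part by (auto simp: tribes_partition_def)
  have disj: "T j \<inter> T k = {}" if "j \<in> {1..m}" "k \<in> {1..m}" "j \<noteq> k" for j k
    using part that unfolding tribes_partition_def disjoint_family_on_def by blast
  have fin: "finite (T j)" if "j \<in> {1..m}" for j
    by (rule finite_subset[of _ "{1..?n}"]) (use union that in blast, simp)
  define blk where "blk i = (THE j. j \<in> {1..m} \<and> i \<in> T j)" for i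
  have blk: "blk i = j" if "j \<in> {1..m}" "i \<in> T j" for i j
    unfolding blk_def by (rule the_equality) (use that disj in blast)+
  have regroup: "(\<Prod>j=1..m. \<Prod>i\<in>T j. F i) = (\<Prod>i=1..?n. F i)" for F :: "nat \<Rightarrow> real"
    unfolding union[symmetric] by (rule prod.UNION_disjoint[symmetric]) (use fin disj in auto)
  have expand: "(\<Prod>j=1..m. \<Sum>k\<in>K. w k * (\<Prod>i\<in>T j. h k (x i)))
      = (\<Sum>\<phi>\<in>?\<Phi>. (\<Prod>j=1..m. w (\<phi> j)) * (\<Prod>i=1..?n. h (\<phi> (blk i)) (x i)))" for x
  proof -
    have "(\<Prod>j=1..m. \<Prod>i\<in>T j. h (\<phi> j) (x i)) = (\<Prod>i=1..?n. h (\<phi> (blk i)) (x i))" for \<phi>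
      unfolding regroup[symmetric] by (intro prod.cong refl) (simp add: blk)
    then show ?thesis using K by (simp add: prod_sum_PiE prod.distrib)
  qed
  have "word_exp q ?n \<mu> (\<lambda>x. \<Prod>j=1..m. \<Sum>k\<in>K. w k * (\<Prod>i\<in>T j. h k (x i)))
      = (\<Sum>\<phi>\<in>?\<Phi>. (\<Prod>j=1..m. w (\<phi> j)) *
          (\<Sum>x\<in>words q ?n. \<Prod>i=1..?n. \<mu> (x i) * h (\<phi> (blk i)) (x i)))"
    unfolding word_exp_def expand sum_distrib_left
    by (subst sum.swap) (simp add: prod.distrib mult_ac)
  also have "\<dots> = (\<Sum>\<phi>\<in>?\<Phi>. (\<Prod>j=1..m. w (\<phi> j)) * (\<Prod>i=1..?n. ?H (\<phi> (blk i))))"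
    by (subst prod_sum_PiE) auto
  also have "\<dots> = (\<Sum>\<phi>\<in>?\<Phi>. (\<Prod>j=1..m. w (\<phi> j)) * (\<Prod>j=1..m. ?H (\<phi> j) ^ r))"
  proof (intro sum.cong refl arg_cong2[where f = "(*)"])
    fix \<phi>
    have "(\<Prod>i=1..?n. ?H (\<phi> (blk i))) = (\<Prod>j=1..m. \<Prod>i\<in>T j. ?H (\<phi> j))"
      unfolding regroup[symmetric] by (intro prod.cong refl) (simp add: blk)
    then show "(\<Prod>i=1..?n. ?H (\<phi> (blk i))) = (\<Prod>j=1..m. ?H (\<phi> j) ^ r)"
      by (simp add: card)
  qed
  also have "\<dots> = (\<Prod>j=1..m. \<Sum>k\<in>K. w k * ?H k ^ r)"
    using K by (subst prod_sum_PiE) (auto simp: prod.distrib)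
  finally show ?thesis by simp
qed

text \<open>
  The joint generating function of the counts of two letters \<open>b\<close> and \<open>c\<close>. All probability estimates
  are special cases: \<open>\<alpha> = -1, \<beta> = 0\<close> gives the event of no unanimous block for \<open>b\<close>, and an
  exponential weight compares the two counts.
\<close>

lemma word_exp_two_votes:
  assumes \<mu>: "\<mu> \<in> prob_simplex q" and part: "tribes_partition m r T" and bc: "b < q" "c < q"
  shows "word_exp q (m * r) \<mu> (\<lambda>x. \<Prod>j=1..m.
      1 + \<alpha> * of_bool (\<forall>i\<in>T j. x i = b) + \<beta> * of_bool (\<forall>i\<in>T j. x i = c))
    = (1 + \<alpha> * \<mu> b ^ r + \<beta> * \<mu> c ^ r) ^ m"
proof -
  define w where "w k = (if k = 0 then 1 else if k = 1 then \<alpha> else \<beta>)" for k :: nat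
  define h where "h k v = (if k = 0 then 1 else if k = 1 then of_bool (v = b) else of_bool (v = c) :: real)"
    for k v :: nat
  have fin: "finite (T j)" if "j \<in> {1..m}" for j
    by (rule finite_subset[of _ "{1..m * r}"]) (use part that in \<open>auto simp: tribes_partition_def\<close>)
  have K: "{..<3} = {0, 1, 2::nat}" by auto
  have ind: "(\<Prod>i\<in>A. of_bool (x i = v)) = (of_bool (\<forall>i\<in>A. x i = v) :: real)"
    if "finite A" for A v and x :: "nat \<Rightarrow> nat"
    using that by (induction A) auto
  have point: "(\<Sum>v<q. \<mu> v * of_bool (v = a)) = \<mu> a" if "a < q" for a
    using that by (simp add: of_bool_def if_distrib[of "\<lambda>z. _ * z"] cong: if_cong)
  have "word_exp q (m * r) \<mu> (\<lambda>x. \<Prod>j=1..m.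
      1 + \<alpha> * of_bool (\<forall>i\<in>T j. x i = b) + \<beta> * of_bool (\<forall>i\<in>T j. x i = c))
    = word_exp q (m * r) \<mu> (\<lambda>x. \<Prod>j=1..m. \<Sum>k\<in>{..<3}. w k * (\<Prod>i\<in>T j. h k (x i)))"
    unfolding K word_exp_def
    by (intro sum.cong prod.cong refl arg_cong2[where f = "(*)"]) (simp add: w_def h_def ind fin add.assoc)
  also have "\<dots> = (\<Sum>k\<in>{..<3}. w k * (\<Sum>v<q. \<mu> v * h k v) ^ r) ^ m"
    by (rule word_exp_prod_blocks) (use part in auto)
  also have "(\<Sum>v<q. \<mu> v) = 1" using \<mu> by (simp add: prob_simplex_def)
  then have "(\<Sum>k\<in>{..<3}. w k * (\<Sum>v<q. \<mu> v * h k v) ^ r) = 1 + \<alpha> * \<mu> b ^ r + \<beta> * \<mu> c ^ r"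
    unfolding K by (simp add: w_def h_def point bc add.assoc)
  finally show ?thesis .
qed

lemma word_exp_no_votes:
  assumes \<mu>: "\<mu> \<in> prob_simplex q" and part: "tribes_partition m r T" and b: "b < q"
  shows "word_exp q (m * r) \<mu> (\<lambda>x. of_bool (unanimous_tribes m T b x = 0)) = (1 - \<mu> b ^ r) ^ m"
proof -
  have "of_bool (unanimous_tribes m T b x = 0)
      = (\<Prod>j=1..m. 1 + (- 1) * of_bool (\<forall>i\<in>T j. x i = b) + 0 * of_bool (\<forall>i\<in>T j. x i = b) :: real)" for x
  proof (cases "unanimous_tribes m T b x = 0")
    case True
    then have "\<not> (\<forall>i\<in>T j. x i = b)" if "j \<in> {1..m}" for j
      using that by (auto simp: unanimous_tribes_def)
    then have "(\<Prod>j=1..m. 1 + (- 1) * of_bool (\<forall>i\<in>T j. x i = b) + 0 * of_bool (\<forall>i\<in>T j. x i = b) :: real) = 1"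
      by (intro prod.neutral) simp
    with True show ?thesis by simp
  next
    case False
    then have "{j\<in>{1..m}. \<forall>i\<in>T j. x i = b} \<noteq> {}"
      by (auto simp: unanimous_tribes_def simp del: Collect_empty_eq)
    then obtain j where "j \<in> {1..m}" "\<forall>i\<in>T j. x i = b" by blast
    then have "(\<Prod>j=1..m. 1 - of_bool (\<forall>i\<in>T j. x i = b) :: real) = 0"
      by (intro prod_zero) (auto intro!: bexI[of _ j])
    with False show ?thesis by simp
  qed
  then show ?thesis
    using word_exp_two_votes[OF \<mu> part b b, of "- 1" 0] by simp
qed

lemma prob_simplex_le_1: "\<mu> \<in> prob_simplex q \<Longrightarrow> b < q \<Longrightarrow> 0 \<le> \<mu> b \<and> \<mu> b \<le> 1"
  using member_le_sum[of b "{..<q}" \<mu>] by (auto simp: prob_simplex_def)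

lemma word_exp_some_vote_le:
  assumes \<mu>: "\<mu> \<in> prob_simplex q" and part: "tribes_partition m r T" and b: "b < q"
  shows "word_exp q (m * r) \<mu> (\<lambda>x. of_bool (unanimous_tribes m T b x \<noteq> 0)) \<le> m * \<mu> b ^ r"
proof -
  have "of_bool (unanimous_tribes m T b x \<noteq> 0) = (1 - of_bool (unanimous_tribes m T b x = 0) :: real)" for x
    by simp
  then have "word_exp q (m * r) \<mu> (\<lambda>x. of_bool (unanimous_tribes m T b x \<noteq> 0)) = 1 - (1 - \<mu> b ^ r) ^ m"
    by (simp only: word_exp_diff word_exp_one[OF \<mu>] word_exp_no_votes[OF assms])
  also have "\<dots> \<le> m * \<mu> b ^ r"
    using Bernoulli_inequality[of "- (\<mu> b ^ r)" m] prob_simplex_le_1[OF \<mu> b]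
    by (simp add: power_le_one)
  finally show ?thesis .
qed

text \<open>
  A Chernoff bound: with \<open>w = 1 - \<delta> / 2\<close>, the indicator of \<open>N\<^sub>b \<le> N\<^sub>c\<close> is at most
  \<open>w\<close> to the power \<open>N\<^sub>b - N\<^sub>c\<close>, and the expectation of that power factorizes over the blocks.
\<close>

lemma word_exp_overtake_le:
  assumes \<mu>: "\<mu> \<in> prob_simplex q" and part: "tribes_partition m r T" and bc: "b < q" "c < q" "b \<noteq> c"
    and r: "r \<ge> 1" and \<delta>: "0 \<le> \<delta>" "\<delta> \<le> 1" and less: "\<mu> c ^ r \<le> (1 - \<delta>) * \<mu> b ^ r"
  shows "word_exp q (m * r) \<mu> (\<lambda>x. of_bool (unanimous_tribes m T b x \<le> unanimous_tribes m T c x))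
    \<le> exp (- (m * \<mu> b ^ r * \<delta>\<^sup>2 / 4))"
proof -
  define w where "w = 1 - \<delta> / 2"
  have w: "0 < w" "w \<le> 1" using \<delta> by (auto simp: w_def)
  let ?A = "\<lambda>x j. \<forall>i\<in>T j. x i = b" and ?B = "\<lambda>x j. \<forall>i\<in>T j. x i = c"
  let ?p = "\<mu> b ^ r"
  have p: "0 \<le> ?p" "?p \<le> 1" using prob_simplex_le_1[OF \<mu> bc(1)] by (auto simp: power_le_one)
  have "T j \<noteq> {}" if "j \<in> {1..m}" for j
  proof -
    have "card (T j) = r" using part that by (simp add: tribes_partition_def)
    with r show ?thesis by auto
  qed
  then have excl: "\<not> (?A x j \<and> ?B x j)" if "j \<in> {1..m}" for x j
    using bc(3) that by (metis equals0I)
  have count: "(\<Prod>j=1..m. if \<forall>i\<in>T j. x i = a then y else 1) = y ^ unanimous_tribes m T a x"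
    for a x and y :: real
    unfolding unanimous_tribes_def by (subst prod.inter_filter[symmetric]) simp_all
  have split: "1 + (w - 1) * of_bool P + (1 / w - 1) * of_bool Q
      = (if P then w else 1) * (if Q then 1 / w else 1)" if "\<not> (P \<and> Q)" for P Q
    using that by auto
  have "(\<Prod>j=1..m. 1 + (w - 1) * of_bool (?A x j) + (1 / w - 1) * of_bool (?B x j))
      = w ^ unanimous_tribes m T b x * (1 / w) ^ unanimous_tribes m T c x" for x
  proof -
    have "(\<Prod>j=1..m. 1 + (w - 1) * of_bool (?A x j) + (1 / w - 1) * of_bool (?B x j))
      = (\<Prod>j=1..m. (if ?A x j then w else 1) * (if ?B x j then 1 / w else 1))"
      by (intro prod.cong refl split excl)
    then show ?thesis by (simp only: prod.distrib count)
  qed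
  moreover have "of_bool (k \<le> l) \<le> w ^ k * (1 / w) ^ l" for k l :: nat
  proof (cases "k \<le> l")
    case True
    then have "w ^ l \<le> w ^ k" using w by (intro power_decreasing) auto
    then show ?thesis using True w by (simp add: power_divide field_simps)
  qed (use w in auto)
  ultimately have "word_exp q (m * r) \<mu> (\<lambda>x. of_bool (unanimous_tribes m T b x \<le> unanimous_tribes m T c x))
    \<le> word_exp q (m * r) \<mu> (\<lambda>x. \<Prod>j=1..m. 1 + (w - 1) * of_bool (?A x j) + (1 / w - 1) * of_bool (?B x j))"
    by (intro word_exp_mono[OF \<mu>]) simp
  also have "\<dots> = (1 + (w - 1) * ?p + (1 / w - 1) * \<mu> c ^ r) ^ m"
    by (rule word_exp_two_votes[OF \<mu> part bc(1,2)])
  also have "\<dots> \<le> exp (- (?p * \<delta>\<^sup>2 / 4)) ^ m"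
  proof (rule power_mono)
    have "(1 - w) * ?p \<le> 1" using w p by (intro mult_le_one) auto
    moreover have "0 \<le> (1 / w - 1) * \<mu> c ^ r"
      using w prob_simplex_le_1[OF \<mu> bc(2)] by simp
    ultimately show "0 \<le> 1 + (w - 1) * ?p + (1 / w - 1) * \<mu> c ^ r"
      by (simp add: algebra_simps)
    \<comment> \<open>The ratio of the two success probabilities is at most \<open>w\<^sup>2\<close>, which makes \<open>w\<close> a good tilt.\<close>
    have "1 - \<delta> \<le> w\<^sup>2" by (simp add: w_def power2_eq_square algebra_simps)
    then have "\<mu> c ^ r \<le> w\<^sup>2 * ?p" using less p by (meson mult_right_mono order.trans)
    then have "(1 / w - 1) * \<mu> c ^ r \<le> (1 / w - 1) * (w\<^sup>2 * ?p)"
      using w by (intro mult_left_mono) auto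
    also have "\<dots> = w * ?p - w\<^sup>2 * ?p" using w by (simp add: field_simps power2_eq_square)
    finally have "1 + (w - 1) * ?p + (1 / w - 1) * \<mu> c ^ r \<le> 1 - ?p * \<delta>\<^sup>2 / 4"
      by (simp add: w_def power2_eq_square algebra_simps)
    also have "\<dots> \<le> exp (- (?p * \<delta>\<^sup>2 / 4))"
      using exp_ge_add_one_self[of "- (?p * \<delta>\<^sup>2 / 4)"] by simp
    finally show "1 + (w - 1) * ?p + (1 / w - 1) * \<mu> c ^ r \<le> exp (- (?p * \<delta>\<^sup>2 / 4))" .
  qed
  also have "\<dots> = exp (- (m * ?p * \<delta>\<^sup>2 / 4))"
    by (simp add: exp_of_nat_mult[symmetric] mult.assoc)
  finally show ?thesis .
qed


section \<open>Bounds on the distribution of the outcome\<close>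

definition tribes_prob :: "nat \<Rightarrow> nat \<Rightarrow> nat \<Rightarrow> (nat \<Rightarrow> nat set) \<Rightarrow> (nat \<Rightarrow> real) \<Rightarrow> nat \<Rightarrow> real" where
  "tribes_prob q m r T \<mu> a = word_exp q (m * r) \<mu> (\<lambda>x. of_bool (gen_tribes q m T x = a))"

context
  fixes q m r :: nat and T :: "nat \<Rightarrow> nat set" and \<mu> :: "nat \<Rightarrow> real"
  assumes q: "q \<ge> 2" and \<mu>: "\<mu> \<in> prob_simplex q" and part: "tribes_partition m r T"
begin

lemma tribes_prob_add_le_1:
  assumes "a \<noteq> b"
  shows "tribes_prob q m r T \<mu> a + tribes_prob q m r T \<mu> b \<le> 1"
proof -
  have "tribes_prob q m r T \<mu> a + tribes_prob q m r T \<mu> b \<le> word_exp q (m * r) \<mu> (\<lambda>x. 1)"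
    unfolding tribes_prob_def word_exp_add[symmetric]
    by (rule word_exp_mono[OF \<mu>]) (use assms in \<open>auto simp: of_bool_def\<close>)
  then show ?thesis by (simp add: word_exp_one[OF \<mu>])
qed

lemma gen_tribes_eq_strict_max:
  assumes "a < q" "\<And>c. c < q \<Longrightarrow> c \<noteq> a \<Longrightarrow> unanimous_tribes m T c x < unanimous_tribes m T a x"
  shows "gen_tribes q m T x = a"
proof -
  have "unanimous_tribes m T c x \<le> unanimous_tribes m T a x" if "c < q" for c
    using assms(2)[of c] that by (cases "c = a") auto
  with assms q show ?thesis by (subst gen_tribes_eq_iff) auto
qed

text \<open>
  A union bound: \<open>a\<close> wins if \<open>P\<close> holds and none of the bad events \<open>Q c\<close>, at most \<open>q\<close> in number,
  occurs.
\<close>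

lemma tribes_prob_ge_of_losers:
  fixes e :: real
  assumes win: "\<And>x. x \<in> words q (m * r) \<Longrightarrow> P x \<Longrightarrow> (\<And>c. c \<in> S \<Longrightarrow> \<not> Q c x) \<Longrightarrow> gen_tribes q m T x = a"
    and Q: "\<And>c. c \<in> S \<Longrightarrow> word_exp q (m * r) \<mu> (\<lambda>x. of_bool (Q c x)) \<le> e" and S: "S \<subseteq> {..<q}" and e: "0 \<le> e"
  shows "word_exp q (m * r) \<mu> (\<lambda>x. of_bool (P x)) - q * e \<le> tribes_prob q m r T \<mu> a"
proof -
  have fin: "finite S" by (rule finite_subset[OF S]) simp
  have "(\<Sum>c\<in>S. word_exp q (m * r) \<mu> (\<lambda>x. of_bool (Q c x))) \<le> card S * e"
    using sum_bounded_above[of S _ e] Q by simp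
  also have "card S * e \<le> q * e"
    using card_mono[OF _ S] e by (intro mult_right_mono) auto
  finally have "word_exp q (m * r) \<mu> (\<lambda>x. of_bool (P x)) - q * e
    \<le> word_exp q (m * r) \<mu> (\<lambda>x. of_bool (P x) - (\<Sum>c\<in>S. of_bool (Q c x)))"
    by (simp add: word_exp_diff word_exp_sum)
  also have "\<dots> \<le> tribes_prob q m r T \<mu> a"
    unfolding tribes_prob_def
  proof (rule word_exp_mono[OF \<mu>])
    fix x assume x: "x \<in> words q (m * r)"
    show "of_bool (P x) - (\<Sum>c\<in>S. of_bool (Q c x)) \<le> (of_bool (gen_tribes q m T x = a) :: real)"
    proof (cases "\<exists>c\<in>S. Q c x")
      case True
      then obtain c where "c \<in> S" "Q c x" by blast
      then have "1 \<le> (\<Sum>c\<in>S. of_bool (Q c x) :: real)"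
        using member_le_sum[of c S "\<lambda>c. of_bool (Q c x) :: real"] fin by simp
      then show ?thesis by (simp split: split_of_bool)
    next
      case False
      then have "(\<Sum>c\<in>S. of_bool (Q c x) :: real) = 0" by simp
      then show ?thesis using win[OF x] False by (simp split: split_of_bool)
    qed
  qed
  finally show ?thesis .
qed

text \<open>
  A letter other than \<open>0\<close> can only win with at least one unanimous block, since \<open>0\<close> wins the tie of
  zero counts.
\<close>

lemma tribes_prob_le_vote:
  assumes "a < q" "a \<noteq> 0"
  shows "tribes_prob q m r T \<mu> a \<le> 1 - (1 - \<mu> a ^ r) ^ m"
proof -
  have "tribes_prob q m r T \<mu> a \<le> word_exp q (m * r) \<mu> (\<lambda>x. 1 - of_bool (unanimous_tribes m T a x = 0))"
    unfolding tribes_prob_def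
  proof (rule word_exp_mono[OF \<mu>])
    fix x
    have "unanimous_tribes m T 0 x < unanimous_tribes m T a x" if "gen_tribes q m T x = a"
      using that assms q by (simp add: gen_tribes_eq_iff)
    then show "of_bool (gen_tribes q m T x = a) \<le> (1 - of_bool (unanimous_tribes m T a x = 0) :: real)"
      by (auto split: split_of_bool)
  qed
  then show ?thesis
    by (simp add: word_exp_diff word_exp_one[OF \<mu>] word_exp_no_votes[OF \<mu> part assms(1)])
qed

text \<open>One unanimous block suffices to win when no other letter has any.\<close>

lemma tribes_prob_ge_vote:
  fixes e :: real
  assumes a: "a < q" and e: "\<And>c. c < q \<Longrightarrow> c \<noteq> a \<Longrightarrow> m * \<mu> c ^ r \<le> e" "0 \<le> e"
  shows "1 - (1 - \<mu> a ^ r) ^ m - q * e \<le> tribes_prob q m r T \<mu> a"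
proof -
  have "word_exp q (m * r) \<mu> (\<lambda>x. of_bool (unanimous_tribes m T a x \<noteq> 0)) - q * e
      \<le> tribes_prob q m r T \<mu> a"
  proof (rule tribes_prob_ge_of_losers[of _ "{..<q} - {a}" "\<lambda>c x. unanimous_tribes m T c x \<noteq> 0"])
    fix c assume "c \<in> {..<q} - {a}"
    then show "word_exp q (m * r) \<mu> (\<lambda>x. of_bool (unanimous_tribes m T c x \<noteq> 0)) \<le> e"
      using word_exp_some_vote_le[OF \<mu> part, of c] e(1)[of c] by simp
  next
    fix x assume *: "unanimous_tribes m T a x \<noteq> 0"
      "\<And>c. c \<in> {..<q} - {a} \<Longrightarrow> \<not> unanimous_tribes m T c x \<noteq> 0"
    have "unanimous_tribes m T c x < unanimous_tribes m T a x" if "c < q" "c \<noteq> a" for c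
      using *(1) *(2)[of c] that by auto
    then show "gen_tribes q m T x = a" using a q by (intro gen_tribes_eq_strict_max) auto
  qed (use e in auto)
  moreover have "(\<lambda>x. of_bool (unanimous_tribes m T a x \<noteq> 0))
      = (\<lambda>x. 1 - of_bool (unanimous_tribes m T a x = 0) :: real)"
    by auto
  ultimately show ?thesis
    by (simp only: word_exp_diff word_exp_one[OF \<mu>] word_exp_no_votes[OF \<mu> part a])
qed

text \<open>
  The letter \<open>0\<close> is the default outcome: it wins when no other letter has a unanimous block, however
  many blocks it has itself. The letter \<open>b\<close> is the one in the critical window, for which the union
  bound would be too weak.
\<close>

lemma tribes_prob_0_ge:
  fixes e :: real
  assumes b: "b < q" and e: "\<And>c. c < q \<Longrightarrow> c \<noteq> 0 \<Longrightarrow> c \<noteq> b \<Longrightarrow> m * \<mu> c ^ r \<le> e" "0 \<le> e"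
  shows "(1 - \<mu> b ^ r) ^ m - q * e \<le> tribes_prob q m r T \<mu> 0"
  unfolding word_exp_no_votes[OF \<mu> part b, symmetric]
proof (rule tribes_prob_ge_of_losers[of _ "{..<q} - {0, b}" "\<lambda>c x. unanimous_tribes m T c x \<noteq> 0"])
  fix c assume "c \<in> {..<q} - {0, b}"
  then show "word_exp q (m * r) \<mu> (\<lambda>x. of_bool (unanimous_tribes m T c x \<noteq> 0)) \<le> e"
    using word_exp_some_vote_le[OF \<mu> part, of c] e(1)[of c] by simp
next
  fix x assume *: "unanimous_tribes m T b x = 0"
    "\<And>c. c \<in> {..<q} - {0, b} \<Longrightarrow> \<not> unanimous_tribes m T c x \<noteq> 0"
  have "unanimous_tribes m T c x \<le> unanimous_tribes m T 0 x" if "c < q" for c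
    using *(1) *(2)[of c] that by (cases "c = 0"; cases "c = b") auto
  then show "gen_tribes q m T x = 0" using q by (subst gen_tribes_eq_iff) auto
qed (use e in auto)

lemma tribes_prob_0_ge_all:
  fixes e :: real
  assumes e: "\<And>c. c < q \<Longrightarrow> c \<noteq> 0 \<Longrightarrow> m * \<mu> c ^ r \<le> e" "0 \<le> e"
  shows "1 - q * e \<le> tribes_prob q m r T \<mu> 0"
proof -
  have "word_exp q (m * r) \<mu> (\<lambda>x. of_bool True) - q * e \<le> tribes_prob q m r T \<mu> 0"
  proof (rule tribes_prob_ge_of_losers[of _ "{..<q} - {0}" "\<lambda>c x. unanimous_tribes m T c x \<noteq> 0"])
    fix c assume "c \<in> {..<q} - {0}"
    then show "word_exp q (m * r) \<mu> (\<lambda>x. of_bool (unanimous_tribes m T c x \<noteq> 0)) \<le> e"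
      using word_exp_some_vote_le[OF \<mu> part, of c] e(1)[of c] by simp
  next
    fix x assume *: "\<And>c. c \<in> {..<q} - {0} \<Longrightarrow> \<not> unanimous_tribes m T c x \<noteq> 0"
    have "unanimous_tribes m T c x \<le> unanimous_tribes m T 0 x" if "c < q" for c
      using *[of c] that by (cases "c = 0") auto
    then show "gen_tribes q m T x = 0" using q by (subst gen_tribes_eq_iff) auto
  qed (use e in auto)
  then show ?thesis by (simp add: word_exp_one[OF \<mu>])
qed

lemma tribes_prob_ge_dominant:
  assumes b: "b < q" and r: "r \<ge> 1" and \<delta>: "0 \<le> \<delta>" "\<delta> \<le> 1"
    and less: "\<And>c. c < q \<Longrightarrow> c \<noteq> b \<Longrightarrow> \<mu> c \<le> \<mu> b - \<delta>"
  shows "1 - q * exp (- (m * \<mu> b ^ r * \<delta>\<^sup>2 / 4)) \<le> tribes_prob q m r T \<mu> b"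
proof -
  have "word_exp q (m * r) \<mu> (\<lambda>x. of_bool True) - q * exp (- (m * \<mu> b ^ r * \<delta>\<^sup>2 / 4))
      \<le> tribes_prob q m r T \<mu> b"
  proof (rule tribes_prob_ge_of_losers[of _ "{..<q} - {b}"
        "\<lambda>c x. unanimous_tribes m T b x \<le> unanimous_tribes m T c x"])
    fix c assume c: "c \<in> {..<q} - {b}"
    have "\<mu> c \<le> (1 - \<delta>) * \<mu> b"
      using less[of c] c prob_simplex_le_1[OF \<mu> b] \<delta>
        mult_left_mono[of "\<mu> b" 1 \<delta>] by (simp add: algebra_simps)
    then have "\<mu> c ^ r \<le> ((1 - \<delta>) * \<mu> b) ^ r"
      using c prob_simplex_le_1[OF \<mu>, of c] by (intro power_mono) auto
    also have "\<dots> \<le> (1 - \<delta>) * \<mu> b ^ r"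
      unfolding power_mult_distrib using \<delta> r prob_simplex_le_1[OF \<mu> b]
      by (intro mult_right_mono power_le_one_iff[THEN iffD2] power_decreasing[of 1 r "1 - \<delta>", simplified])
        auto
    finally show "word_exp q (m * r) \<mu> (\<lambda>x. of_bool (unanimous_tribes m T b x \<le> unanimous_tribes m T c x))
      \<le> exp (- (m * \<mu> b ^ r * \<delta>\<^sup>2 / 4))"
      using c by (intro word_exp_overtake_le[OF \<mu> part b _ _ r \<delta>]) auto
  next
    fix x assume *: "\<And>c. c \<in> {..<q} - {b} \<Longrightarrow> \<not> unanimous_tribes m T b x \<le> unanimous_tribes m T c x"
    have "unanimous_tribes m T c x < unanimous_tribes m T b x" if "c < q" "c \<noteq> b" for c
      using *[of c] that by auto
    then show "gen_tribes q m T x = b" using b by (intro gen_tribes_eq_strict_max) auto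
  qed auto
  then show ?thesis by (simp add: word_exp_one[OF \<mu>])
qed

end


section \<open>The critical window\<close>

lemma tribes_rho_bounds:
  assumes "q \<ge> 2"
  shows "0 < tribes_rho q" "tribes_rho q < 1"
  using assms by (auto simp: tribes_rho_def)

lemma tribes_m_bounds:
  assumes "q \<ge> 2"
  shows "real (tribes_m q r) * tribes_rho q ^ r \<le> 1"
    and "1 - tribes_rho q ^ r \<le> real (tribes_m q r) * tribes_rho q ^ r"
proof -
  let ?\<rho> = "tribes_rho q"
  have pos: "0 < ?\<rho> ^ r" using tribes_rho_bounds[OF assms] by simp
  have "?\<rho> powi (- int r) = 1 / ?\<rho> ^ r" by (simp add: power_int_minus divide_inverse)
  then have m: "real (tribes_m q r) = of_int \<lfloor>1 / ?\<rho> ^ r\<rfloor>"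
    using pos by (simp add: tribes_m_def)
  have "real (tribes_m q r) \<le> 1 / ?\<rho> ^ r" unfolding m by linarith
  then show "real (tribes_m q r) * ?\<rho> ^ r \<le> 1" using pos by (simp add: field_simps)
  have "1 / ?\<rho> ^ r - 1 \<le> real (tribes_m q r)" unfolding m by linarith
  then have "(1 / ?\<rho> ^ r - 1) * ?\<rho> ^ r \<le> real (tribes_m q r) * ?\<rho> ^ r"
    using pos by (intro mult_right_mono) auto
  then show "1 - ?\<rho> ^ r \<le> real (tribes_m q r) * ?\<rho> ^ r"
    using tribes_rho_bounds[OF assms] by (simp add: left_diff_distrib)
qed

lemma tribes_rho_power_tendsto: "q \<ge> 2 \<Longrightarrow> (\<lambda>r. tribes_rho q ^ r) \<longlonglongrightarrow> 0"
  using tribes_rho_bounds[of q] by (intro LIMSEQ_power_zero) auto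

lemma tribes_m_tendsto:
  assumes "q \<ge> 2"
  shows "(\<lambda>r. real (tribes_m q r) * tribes_rho q ^ r) \<longlonglongrightarrow> 1"
proof (rule tendsto_sandwich)
  show "(\<lambda>r. 1 - tribes_rho q ^ r) \<longlonglongrightarrow> 1"
    using tendsto_diff[OF tendsto_const[of 1] tribes_rho_power_tendsto[OF assms]] by simp
  show "(\<lambda>r. 1 :: real) \<longlonglongrightarrow> 1" by simp
qed (use tribes_m_bounds[OF assms] in \<open>auto intro: always_eventually\<close>)

text \<open>
  A letter of probability \<open>\<rho> exp (s / r)\<close> has about \<open>exp s\<close> unanimous blocks, Poisson distributed
  in the limit. The critical window is thus of width \<open>1 / r\<close> around \<open>\<rho>\<close>.
\<close>

definition window_point :: "nat \<Rightarrow> real \<Rightarrow> nat \<Rightarrow> real" where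
  "window_point q s r = tribes_rho q * exp (s / real r)"

lemma window_point_power:
  assumes "r \<ge> 1"
  shows "window_point q s r ^ r = tribes_rho q ^ r * exp s"
  using assms by (simp add: window_point_def power_mult_distrib exp_of_nat_mult[symmetric])

text \<open>
  The limit is the probability that a Poisson variable with mean \<open>exp s\<close> vanishes. As a function of
  \<open>s\<close> this is the survival function of the Gumbel distribution for minima.
\<close>

lemma no_votes_tendsto:
  assumes "q \<ge> 2"
  shows "(\<lambda>r. (1 - window_point q s r ^ r) ^ tribes_m q r) \<longlonglongrightarrow> exp (- exp s)"
proof -
  let ?y = "\<lambda>r. tribes_rho q ^ r * exp s"
  have y0: "?y \<longlonglongrightarrow> 0"
    using tendsto_mult_right[OF tribes_rho_power_tendsto[OF assms], of "exp s"] by simp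
  have ypos: "0 < ?y r" for r using tribes_rho_bounds[OF assms] by simp
  have "((\<lambda>y::real. ln (1 - y) / y) \<longlongrightarrow> - 1) (at_right 0)" by real_asymp
  moreover have "filterlim ?y (at_right 0) sequentially"
    by (rule tendsto_imp_filterlim_at_right[OF y0]) (use ypos in \<open>simp add: always_eventually\<close>)
  ultimately have "(\<lambda>r. ln (1 - ?y r) / ?y r) \<longlonglongrightarrow> - 1" by (rule filterlim_compose)
  then have "(\<lambda>r. exp ((real (tribes_m q r) * tribes_rho q ^ r) * exp s * (ln (1 - ?y r) / ?y r)))
      \<longlonglongrightarrow> exp (1 * exp s * - 1)"
    by (intro tendsto_intros tribes_m_tendsto[OF assms])
  moreover have "\<forall>\<^sub>F r in sequentially. ?y r < 1"
    using order_tendstoD(2)[OF y0, of 1] by simp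
  then have "\<forall>\<^sub>F r in sequentially.
      exp ((real (tribes_m q r) * tribes_rho q ^ r) * exp s * (ln (1 - ?y r) / ?y r))
      = (1 - window_point q s r ^ r) ^ tribes_m q r"
    using eventually_ge_at_top[of 1]
  proof eventually_elim
    case (elim r)
    have "(real (tribes_m q r) * tribes_rho q ^ r) * exp s * (ln (1 - ?y r) / ?y r)
        = real (tribes_m q r) * ln (1 - ?y r)"
      using tribes_rho_bounds[OF assms] by simp
    then show ?case using elim by (simp add: exp_of_nat_mult window_point_power)
  qed
  ultimately show ?thesis by (simp add: tendsto_cong)
qed

lemma window_width_tendsto:
  "(\<lambda>r. real r * (window_point q t r - window_point q s r)) \<longlonglongrightarrow> tribes_rho q * (t - s)"
proof -
  have "(\<lambda>r::nat. real r * (exp (t / real r) - exp (s / real r))) \<longlonglongrightarrow> t - s"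
    by real_asymp
  from tendsto_mult_left[OF this, of "tribes_rho q"] show ?thesis
    by (simp add: window_point_def algebra_simps)
qed

lemma window_point_tendsto: "window_point q s \<longlonglongrightarrow> tribes_rho q"
proof -
  have "(\<lambda>r::nat. exp (s / real r)) \<longlonglongrightarrow> 1" by real_asymp
  from tendsto_mult_left[OF this, of "tribes_rho q"] show ?thesis
    by (simp add: window_point_def[abs_def])
qed

lemma ln_tribes_n_tendsto:
  assumes "q \<ge> 2"
  shows "(\<lambda>r. ln (real (tribes_n q r)) / real r) \<longlonglongrightarrow> - ln (tribes_rho q)"
proof -
  let ?\<rho> = "tribes_rho q"
  let ?c = "\<lambda>r. real (tribes_m q r) * ?\<rho> ^ r"
  note \<rho> = tribes_rho_bounds[OF assms]
  have "(\<lambda>r. ln (?c r) * (1 / real r) + (- ln ?\<rho>) + ln (real r) / real r) \<longlonglongrightarrow> ln 1 * 0 + (- ln ?\<rho>) + 0"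
  proof (intro tendsto_add tendsto_mult tendsto_ln tendsto_const tribes_m_tendsto[OF assms])
    show "(\<lambda>r::nat. 1 / real r) \<longlonglongrightarrow> 0" by real_asymp
    show "(\<lambda>r::nat. ln (real r) / real r) \<longlonglongrightarrow> 0" by real_asymp
  qed auto
  moreover have "\<forall>\<^sub>F r in sequentially. ?c r > 0"
    using order_tendstoD(1)[OF tribes_m_tendsto[OF assms], of 0] by simp
  then have "\<forall>\<^sub>F r in sequentially. ln (?c r) * (1 / real r) + (- ln ?\<rho>) + ln (real r) / real r
      = ln (real (tribes_n q r)) / real r"
    using eventually_ge_at_top[of 1]
  proof eventually_elim
    case (elim r)
    then have m: "real (tribes_m q r) > 0" using \<rho> by (simp add: zero_less_mult_iff)
    then have "ln (?c r) = ln (real (tribes_m q r)) + real r * ln ?\<rho>"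
      using \<rho> by (simp add: ln_mult ln_realpow)
    moreover have "ln (real (tribes_n q r)) = ln (real (tribes_m q r)) + ln (real r)"
      using m elim by (simp add: tribes_n_def ln_mult)
    ultimately show ?case using elim by (simp add: field_simps)
  qed
  ultimately show ?thesis by (simp add: tendsto_cong)
qed

text \<open>
  Two small scales will be used: \<open>\<eta> = r\<^sup>-\<^sup>2\<^sup>/\<^sup>3\<close> for the distance to \<open>\<rho>\<close> and \<open>\<delta> = r\<^sup>-\<^sup>2\<close> for the
  distance between two letters. Since \<open>\<eta>\<close> is much larger than \<open>1 / r\<close>, letters below \<open>\<rho> - \<eta>\<close> get no
  block and letters above \<open>\<rho> + \<eta>\<close> get so many that a gap \<open>\<delta>\<close> decides. Since \<open>\<eta>\<^sup>2\<close> and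
  \<open>\<delta>\<close> are much smaller than \<open>1 / r\<close>, the sets discarded at these scales are negligible.
\<close>

lemma supercritical_tendsto:
  "(\<lambda>r::nat. exp (- ((1 + real r powr (- 2 / 3)) ^ r * (1 / real r ^ 2)\<^sup>2 / 8))) \<longlonglongrightarrow> 0"
  by real_asymp

lemma subcritical_tendsto: "(\<lambda>r::nat. (1 - real r powr (- 2 / 3)) ^ r) \<longlonglongrightarrow> 0"
  by real_asymp


section \<open>The length of the window\<close>

text \<open>
  The length of the interval of all \<open>s\<close> with \<open>exp (- exp s)\<close> between \<open>\<epsilon>\<close> and \<open>1 - \<epsilon>\<close>. It is
  comparable to the logarithm of the odds \<open>(1 - \<epsilon>) / \<epsilon>\<close>, both for \<open>\<epsilon>\<close> near \<open>0\<close> and near \<open>1/2\<close>: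
  as integrals over \<open>[\<epsilon>, 1 - \<epsilon>]\<close> the two quantities have integrands \<open>1 / (x (- ln x))\<close> and
  \<open>1 / (2 x (1 - x))\<close>.
\<close>

definition gumbel_length :: "real \<Rightarrow> real" where
  "gumbel_length \<epsilon> = ln (- ln \<epsilon>) - ln (- ln (1 - \<epsilon>))"

lemma gumbel_length_le:
  assumes "0 < \<epsilon>" "\<epsilon> < 1 / 2"
  shows "gumbel_length \<epsilon> \<le> 2 * ln ((1 - \<epsilon>) / \<epsilon>)"
proof -
  \<comment> \<open>The derivative of \<open>F\<close> is the integrand \<open>1 / (x (1 - x))\<close> minus the integrand \<open>1 / (x (- ln x))\<close>.\<close>
  define F :: "real \<Rightarrow> real" where "F x = ln x - ln (1 - x) + ln (- ln x)" for x
  have "F \<epsilon> \<le> F (1 - \<epsilon>)"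
  proof (rule DERIV_nonneg_imp_nondecreasing[where f = F])
    fix x assume "\<epsilon> \<le> x" "x \<le> 1 - \<epsilon>"
    then have x: "0 < x" "x < 1" using assms by auto
    then have ln: "0 < - ln x" "1 - x \<le> - ln x" using ln_le_minus_one[of x] by auto
    have "(F has_real_derivative (1 / x + 1 / (1 - x) + 1 / (x * ln x))) (at x)"
      unfolding F_def[abs_def] using x ln by (auto intro!: derivative_eq_intros simp: field_simps)
    moreover have "1 / (x * (- ln x)) \<le> 1 / (x * (1 - x))"
      using x ln by (intro divide_left_mono mult_left_mono mult_pos_pos) auto
    then have "0 \<le> 1 / x + 1 / (1 - x) + 1 / (x * ln x)"
    proof -
      have "1 / x + 1 / (1 - x) = 1 / (x * (1 - x))" using x by (simp add: field_simps)
      with \<open>1 / (x * (- ln x)) \<le> 1 / (x * (1 - x))\<close> show ?thesis by simp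
    qed
    ultimately show "\<exists>y. (F has_real_derivative y) (at x) \<and> 0 \<le> y" by blast
  qed (use assms in auto)
  then show ?thesis using assms by (simp add: F_def gumbel_length_def ln_div)
qed

text \<open>
  Near \<open>x = 0\<close> the first integrand is the smaller one by an unbounded factor. The comparison is
  therefore made on \<open>[1/2, 1 - \<epsilon>]\<close> only, which carries half of the log-odds by symmetry.
\<close>

lemma gumbel_length_ge:
  assumes "0 < \<epsilon>" "\<epsilon> < 1 / 2"
  shows "ln ((1 - \<epsilon>) / \<epsilon>) / 2 \<le> gumbel_length \<epsilon>"
proof -
  define G :: "real \<Rightarrow> real" where "G x = - ln (- ln x) - (ln x - ln (1 - x)) / 2" for x
  have "G (1 / 2) \<le> G (1 - \<epsilon>)"
  proof (rule DERIV_nonneg_imp_nondecreasing[where f = G])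
    fix x :: real assume "1 / 2 \<le> x" "x \<le> 1 - \<epsilon>"
    then have x: "1 / 2 \<le> x" "0 < x" "x < 1" using assms by auto
    have ln: "0 < - ln x" using x by auto
    have "- ln x \<le> 1 / x - 1" using ln_le_minus_one[of "1 / x"] x by (simp add: ln_div)
    also have "\<dots> = (1 - x) * (1 / x)" using x by (simp add: field_simps)
    also have "\<dots> \<le> (1 - x) * 2" using x by (intro mult_left_mono) (auto simp: field_simps)
    finally have ln2: "- ln x \<le> 2 * (1 - x)" by simp
    have "(G has_real_derivative (- 1 / (x * ln x) - (1 / x + 1 / (1 - x)) / 2)) (at x)"
      unfolding G_def[abs_def] using x ln by (auto intro!: derivative_eq_intros simp: field_simps)
    moreover have "1 / (x * (2 * (1 - x))) \<le> 1 / (x * (- ln x))"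
      using x ln ln2 by (intro divide_left_mono mult_left_mono mult_pos_pos) auto
    then have "0 \<le> - 1 / (x * ln x) - (1 / x + 1 / (1 - x)) / 2"
    proof -
      have "(1 / x + 1 / (1 - x)) / 2 = 1 / (x * (2 * (1 - x)))" using x by (simp add: field_simps)
      with \<open>1 / (x * (2 * (1 - x))) \<le> 1 / (x * (- ln x))\<close> show ?thesis by simp
    qed
    ultimately show "\<exists>y. (G has_real_derivative y) (at x) \<and> 0 \<le> y" by blast
  qed (use assms in auto)
  then have "ln (- ln (1 - \<epsilon>)) + ln ((1 - \<epsilon>) / \<epsilon>) / 2 \<le> ln (ln 2)"
    using assms by (simp add: G_def ln_div algebra_simps)
  moreover have "ln (ln 2) \<le> ln (- ln \<epsilon>)"
  proof -
    have "ln 2 \<le> ln (1 / \<epsilon>)" using assms by (subst ln_le_cancel_iff) (auto simp: field_simps)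
    then show ?thesis using assms by (subst ln_le_cancel_iff) (auto simp: ln_div)
  qed
  ultimately show ?thesis by (simp add: gumbel_length_def)
qed


section \<open>Slicing the simplex\<close>

lemma emeasure_PiM_slices:
  fixes I :: "'i set"
  assumes "finite I" "e \<notin> I" and A: "A \<in> sets (\<Pi>\<^sub>M i\<in>insert e I. (lborel :: real measure))"
  shows "emeasure (\<Pi>\<^sub>M i\<in>insert e I. (lborel :: real measure)) A =
    (\<integral>\<^sup>+x. emeasure lborel {y. x(e := y) \<in> A} \<partial>(\<Pi>\<^sub>M i\<in>I. lborel))"
proof -
  interpret product_sigma_finite "\<lambda>_ :: 'i. lborel :: real measure" by standard
  have "emeasure (\<Pi>\<^sub>M i\<in>insert e I. (lborel :: real measure)) A
      = (\<integral>\<^sup>+x. (\<integral>\<^sup>+y. indicator A (x(e := y)) \<partial>lborel) \<partial>(\<Pi>\<^sub>M i\<in>I. lborel))"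
    using A by (subst product_nn_integral_insert[symmetric]) (use assms in auto)
  also have "\<dots> = (\<integral>\<^sup>+x. emeasure lborel {y. x(e := y) \<in> A} \<partial>(\<Pi>\<^sub>M i\<in>I. lborel))"
  proof (intro nn_integral_cong)
    fix x assume x: "x \<in> space (\<Pi>\<^sub>M i\<in>I. (lborel :: real measure))"
    have "(\<lambda>y. x(e := y)) \<in> lborel \<rightarrow>\<^sub>M (\<Pi>\<^sub>M i\<in>insert e I. lborel)"
      by (rule measurable_component_update[OF x \<open>e \<notin> I\<close>])
    from measurable_sets[OF this A] have "{y. x(e := y) \<in> A} \<in> sets lborel"
      by (simp add: vimage_def)
    then have "(\<integral>\<^sup>+y. indicator {y. x(e := y) \<in> A} y \<partial>lborel) = emeasure lborel {y. x(e := y) \<in> A}"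
      by simp
    moreover have "indicator A (x(e := y)) = (indicator {y. x(e := y) \<in> A} y :: ennreal)" for y
      by (simp add: indicator_def)
    ultimately show "(\<integral>\<^sup>+y. indicator A (x(e := y)) \<partial>lborel) = emeasure lborel {y. x(e := y) \<in> A}"
      by simp
  qed
  finally show ?thesis .
qed

lemma nn_integral_box:
  fixes l u :: "'i \<Rightarrow> real"
  assumes "finite I" "\<And>i. i \<in> I \<Longrightarrow> l i \<le> u i" "0 \<le> c"
  shows "(\<integral>\<^sup>+x. ennreal c * indicator (\<Pi>\<^sub>E i\<in>I. {l i..u i}) x \<partial>(\<Pi>\<^sub>M i\<in>I. lborel))
    = ennreal (c * (\<Prod>i\<in>I. u i - l i))"
proof -
  interpret product_sigma_finite "\<lambda>_ :: 'i. lborel :: real measure" by standard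
  have "(\<Pi>\<^sub>E i\<in>I. {l i..u i}) \<in> sets (\<Pi>\<^sub>M i\<in>I. (lborel :: real measure))"
    by (rule sets_PiM_I_finite) (use assms in auto)
  moreover have "emeasure (\<Pi>\<^sub>M i\<in>I. (lborel :: real measure)) (\<Pi>\<^sub>E i\<in>I. {l i..u i}) = (\<Prod>i\<in>I. ennreal (u i - l i))"
    by (subst emeasure_PiM) (use assms in auto)
  moreover have "(\<Prod>i\<in>I. ennreal (u i - l i)) = ennreal (\<Prod>i\<in>I. u i - l i)"
    by (rule prod_ennreal) (use assms in auto)
  ultimately show ?thesis
    using assms by (simp add: nn_integral_cmult_indicator ennreal_mult prod_nonneg)
qed

lemma emeasure_PiM_le_slices:
  fixes l u :: "'i \<Rightarrow> real"
  assumes "finite I" "e \<notin> I" and A: "A \<in> sets (\<Pi>\<^sub>M i\<in>insert e I. (lborel :: real measure))"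
    and box: "\<And>x i. x \<in> A \<Longrightarrow> i \<in> I \<Longrightarrow> x i \<in> {l i..u i}"
    and lu: "\<And>i. i \<in> I \<Longrightarrow> l i \<le> u i"
    and thin: "\<And>x y. x \<in> A \<Longrightarrow> y \<in> A \<Longrightarrow> (\<And>i. i \<in> I \<Longrightarrow> x i = y i) \<Longrightarrow> \<bar>x e - y e\<bar> \<le> w"
    and w: "0 \<le> w"
  shows "emeasure (\<Pi>\<^sub>M i\<in>insert e I. (lborel :: real measure)) A \<le> ennreal (2 * w * (\<Prod>i\<in>I. u i - l i))"
proof -
  have "emeasure (\<Pi>\<^sub>M i\<in>insert e I. (lborel :: real measure)) A
      = (\<integral>\<^sup>+x. emeasure lborel {y. x(e := y) \<in> A} \<partial>(\<Pi>\<^sub>M i\<in>I. lborel))"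
    by (rule emeasure_PiM_slices[OF assms(1-3)])
  also have "\<dots> \<le> (\<integral>\<^sup>+x. ennreal (2 * w) * indicator (\<Pi>\<^sub>E i\<in>I. {l i..u i}) x \<partial>(\<Pi>\<^sub>M i\<in>I. lborel))"
  proof (rule nn_integral_mono)
    fix x assume x: "x \<in> space (\<Pi>\<^sub>M i\<in>I. (lborel :: real measure))"
    show "emeasure lborel {y. x(e := y) \<in> A} \<le> ennreal (2 * w) * indicator (\<Pi>\<^sub>E i\<in>I. {l i..u i}) x"
    proof (cases "{y. x(e := y) \<in> A} = {}")
      case False
      then obtain z where z: "x(e := z) \<in> A" by blast
      have "x i \<in> {l i..u i}" if "i \<in> I" for i
        using box[OF z that] that \<open>e \<notin> I\<close> by (cases "i = e") auto
      with x have "x \<in> (\<Pi>\<^sub>E i\<in>I. {l i..u i})" by (auto simp: space_PiM PiE_iff)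
      moreover have "\<bar>y - z\<bar> \<le> w" if "x(e := y) \<in> A" for y
        using thin[OF that z] \<open>e \<notin> I\<close> by fastforce
      then have "{y. x(e := y) \<in> A} \<subseteq> {z - w..z + w}" by (force simp: abs_le_iff)
      then have "emeasure lborel {y. x(e := y) \<in> A} \<le> emeasure lborel {z - w..z + w}"
        by (rule emeasure_mono) simp
      ultimately show ?thesis using w by simp
    qed simp
  qed
  also have "\<dots> = ennreal (2 * w * (\<Prod>i\<in>I. u i - l i))"
    by (rule nn_integral_box) (use assms in auto)
  finally show ?thesis .
qed

lemma emeasure_PiM_ge_slices:
  fixes l u :: "'i \<Rightarrow> real"
  assumes "finite I" "e \<notin> I" and A: "A \<in> sets (\<Pi>\<^sub>M i\<in>insert e I. (lborel :: real measure))"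
    and lu: "\<And>i. i \<in> I \<Longrightarrow> l i \<le> u i"
    and thick: "\<And>x. x \<in> (\<Pi>\<^sub>E i\<in>I. {l i..u i}) \<Longrightarrow> \<exists>z. \<forall>y\<in>{z..z + w}. x(e := y) \<in> A"
    and w: "0 \<le> w"
  shows "ennreal (w * (\<Prod>i\<in>I. u i - l i)) \<le> emeasure (\<Pi>\<^sub>M i\<in>insert e I. (lborel :: real measure)) A"
proof -
  have "ennreal (w * (\<Prod>i\<in>I. u i - l i))
      = (\<integral>\<^sup>+x. ennreal w * indicator (\<Pi>\<^sub>E i\<in>I. {l i..u i}) x \<partial>(\<Pi>\<^sub>M i\<in>I. lborel))"
    by (rule nn_integral_box[symmetric]) (use assms in auto)
  also have "\<dots> \<le> (\<integral>\<^sup>+x. emeasure lborel {y. x(e := y) \<in> A} \<partial>(\<Pi>\<^sub>M i\<in>I. lborel))"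
  proof (rule nn_integral_mono)
    fix x assume x: "x \<in> space (\<Pi>\<^sub>M i\<in>I. (lborel :: real measure))"
    show "ennreal w * indicator (\<Pi>\<^sub>E i\<in>I. {l i..u i}) x \<le> emeasure lborel {y. x(e := y) \<in> A}"
    proof (cases "x \<in> (\<Pi>\<^sub>E i\<in>I. {l i..u i})")
      case True
      from thick[OF True] obtain z where z: "{z..z + w} \<subseteq> {y. x(e := y) \<in> A}" by blast
      have "(\<lambda>y. x(e := y)) \<in> lborel \<rightarrow>\<^sub>M (\<Pi>\<^sub>M i\<in>insert e I. lborel)"
        by (rule measurable_component_update[OF x \<open>e \<notin> I\<close>])
      from measurable_sets[OF this A] have "{y. x(e := y) \<in> A} \<in> sets lborel"
        by (simp add: vimage_def)
      with z have "emeasure lborel {z..z + w} \<le> emeasure lborel {y. x(e := y) \<in> A}"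
        by (rule emeasure_mono)
      with True w show ?thesis by simp
    qed simp
  qed
  also have "\<dots> = emeasure (\<Pi>\<^sub>M i\<in>insert e I. (lborel :: real measure)) A"
    by (rule emeasure_PiM_slices[OF assms(1-3), symmetric])
  finally show ?thesis .
qed

lemma sets_simplex_measure: "sets (simplex_measure q) = sets (\<Pi>\<^sub>M a\<in>{..<q}. borel)"
  by (simp add: simplex_measure_def)

lemma sets_corner_simplex: "corner_simplex d \<in> sets (\<Pi>\<^sub>M a\<in>{..<d}. lborel)"
  by (rule ccontr) (use emeasure_corner_simplex[of d] in \<open>auto simp: emeasure_notin_sets\<close>)

lemma simplex_coords_sets:
  assumes "B \<in> sets (\<Pi>\<^sub>M a\<in>{..<q}. borel)"
  shows "{x \<in> corner_simplex (q - 1). add_last_coord q x \<in> B} \<in> sets (\<Pi>\<^sub>M a\<in>{..<q - 1}. lborel)"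
proof -
  have "{x \<in> corner_simplex (q - 1). add_last_coord q x \<in> B}
      = corner_simplex (q - 1) \<inter> (add_last_coord q -` B \<inter> space (\<Pi>\<^sub>M a\<in>{..<q - 1}. lborel))"
    using sets.sets_into_space[OF sets_corner_simplex[of "q - 1"]] by auto
  then show ?thesis
    using measurable_sets[OF measurable_add_last_coord assms] sets_corner_simplex[of "q - 1"] by auto
qed

lemma emeasure_simplex_measure:
  assumes B: "B \<in> sets (\<Pi>\<^sub>M a\<in>{..<q}. borel)"
  shows "emeasure (simplex_measure q) B = ennreal (fact (q - 1)) *
    emeasure (\<Pi>\<^sub>M a\<in>{..<q - 1}. lborel) {x \<in> corner_simplex (q - 1). add_last_coord q x \<in> B}"
proof -
  let ?L = "\<Pi>\<^sub>M a\<in>{..<q - 1}. (lborel :: real measure)" and ?C = "corner_simplex (q - 1)"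
  have "emeasure (simplex_measure q) B = emeasure (uniform_measure ?L ?C) (add_last_coord q -` B \<inter> space ?L)"
    unfolding simplex_measure_def using measurable_add_last_coord B
    by (subst emeasure_distr) auto
  also have "\<dots> = emeasure ?L (?C \<inter> (add_last_coord q -` B \<inter> space ?L)) / emeasure ?L ?C"
    using measurable_sets[OF measurable_add_last_coord B] sets_corner_simplex
    by (intro emeasure_uniform_measure) auto
  also have "?C \<inter> (add_last_coord q -` B \<inter> space ?L) = {x \<in> ?C. add_last_coord q x \<in> B}"
    using sets.sets_into_space[OF sets_corner_simplex[of "q - 1"]] by auto
  finally show ?thesis
    by (simp add: emeasure_corner_simplex divide_ennreal_def inverse_ennreal mult.commute)
qed

lemma add_last_coord_in_prob_simplex:
  "q \<ge> 1 \<Longrightarrow> x \<in> corner_simplex (q - 1) \<Longrightarrow> add_last_coord q x \<in> prob_simplex q"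
  using bij_betw_add_last_coord[of q] by (auto simp: bij_betw_def)

text \<open>
  Moving a point of the simplex along one coordinate \<open>e\<close> means exchanging mass between \<open>e\<close> and
  the last letter. A set that meets each such line in a short piece is small.
\<close>

lemma measure_simplex_le_slices:
  fixes l u :: "nat \<Rightarrow> real"
  assumes e: "e < q - 1" and B: "B \<in> sets (\<Pi>\<^sub>M a\<in>{..<q}. borel)"
    and box: "\<And>\<mu> i. \<mu> \<in> prob_simplex q \<Longrightarrow> \<mu> \<in> B \<Longrightarrow> i < q - 1 \<Longrightarrow> i \<noteq> e \<Longrightarrow> \<mu> i \<in> {l i..u i}"
    and lu: "\<And>i. l i \<le> u i"
    and thin: "\<And>\<mu> \<nu>. \<mu> \<in> prob_simplex q \<Longrightarrow> \<nu> \<in> prob_simplex q \<Longrightarrow> \<mu> \<in> B \<Longrightarrow> \<nu> \<in> B \<Longrightarrow>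
      (\<And>i. i < q - 1 \<Longrightarrow> i \<noteq> e \<Longrightarrow> \<mu> i = \<nu> i) \<Longrightarrow> \<mu> e + \<mu> (q - 1) = \<nu> e + \<nu> (q - 1) \<Longrightarrow>
      \<bar>\<mu> e - \<nu> e\<bar> \<le> w"
    and w: "0 \<le> w"
  shows "measure (simplex_measure q) B \<le> fact (q - 1) * (2 * w * (\<Prod>i\<in>{..<q - 1} - {e}. u i - l i))"
proof -
  let ?I = "{..<q - 1} - {e}"
  have I: "insert e ?I = {..<q - 1}" using e by auto
  let ?A = "{x \<in> corner_simplex (q - 1). add_last_coord q x \<in> B}"
  have q: "q \<ge> 1" using e by auto
  have coord: "add_last_coord q x i = x i" if "i < q - 1" for x i
    using that by (auto simp: add_last_coord_def)
  have last: "add_last_coord q x (q - 1) + x e = 1 - (\<Sum>i\<in>?I. x i)" for x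
    using e sum.remove[of "{..<q - 1}" e x] by (simp add: add_last_coord_def)
  have "emeasure (\<Pi>\<^sub>M i\<in>insert e ?I. (lborel :: real measure)) ?A \<le> ennreal (2 * w * (\<Prod>i\<in>?I. u i - l i))"
  proof (rule emeasure_PiM_le_slices)
    show "?A \<in> sets (Pi\<^sub>M (insert e ?I) (\<lambda>i. lborel))" unfolding I by (rule simplex_coords_sets[OF B])
    show "x i \<in> {l i..u i}" if "x \<in> ?A" "i \<in> ?I" for x i
      using box[of "add_last_coord q x" i] that add_last_coord_in_prob_simplex[OF q, of x] coord[of i x] by auto
    show "\<bar>x e - y e\<bar> \<le> w" if "x \<in> ?A" "y \<in> ?A" "\<And>i. i \<in> ?I \<Longrightarrow> x i = y i" for x y
    proof -
      have "(\<Sum>i\<in>?I. x i) = (\<Sum>i\<in>?I. y i)" using that(3) by (intro sum.cong) auto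
      then have "add_last_coord q x e + add_last_coord q x (q - 1) = add_last_coord q y e + add_last_coord q y (q - 1)"
        using last[of x] last[of y] coord[OF e] by simp
      then have "\<bar>add_last_coord q x e - add_last_coord q y e\<bar> \<le> w"
        using that add_last_coord_in_prob_simplex[OF q] by (intro thin) (auto simp: coord)
      then show ?thesis using coord[OF e] by simp
    qed
  qed (use w lu in auto)
  then have "emeasure (simplex_measure q) B \<le> ennreal (fact (q - 1)) * ennreal (2 * w * (\<Prod>i\<in>?I. u i - l i))"
    unfolding emeasure_simplex_measure[OF B] I by (rule mult_left_mono) simp
  also have "\<dots> = ennreal (fact (q - 1) * (2 * w * (\<Prod>i\<in>?I. u i - l i)))"
    using w lu by (subst ennreal_mult) (auto intro!: mult_nonneg_nonneg prod_nonneg)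
  finally have "emeasure (simplex_measure q) B \<le> \<dots>" .
  moreover have "0 \<le> fact (q - 1) * (2 * w * (\<Prod>i\<in>?I. u i - l i))"
    using w lu by (auto intro!: mult_nonneg_nonneg prod_nonneg)
  ultimately show ?thesis unfolding measure_def by (metis enn2real_leI)
qed

text \<open>The same principle from below, for sets that meet every such line over a box in a long piece.\<close>

lemma measure_simplex_ge_slices:
  fixes l u :: "nat \<Rightarrow> real"
  assumes e: "e < q - 1" and B: "B \<in> sets (\<Pi>\<^sub>M a\<in>{..<q}. borel)" and sub: "B \<subseteq> prob_simplex q"
    and lu: "\<And>i. l i \<le> u i"
    and thick: "\<And>x. x \<in> (\<Pi>\<^sub>E i\<in>{..<q - 1} - {e}. {l i..u i}) \<Longrightarrow>
      \<exists>z. \<forall>y\<in>{z..z + w}. add_last_coord q (x(e := y)) \<in> B"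
    and w: "0 \<le> w"
  shows "fact (q - 1) * (w * (\<Prod>i\<in>{..<q - 1} - {e}. u i - l i)) \<le> measure (simplex_measure q) B"
proof -
  interpret prob_space "simplex_measure q" by (rule prob_space_simplex_measure)
  let ?I = "{..<q - 1} - {e}"
  have I: "insert e ?I = {..<q - 1}" using e by auto
  let ?A = "{x \<in> corner_simplex (q - 1). add_last_coord q x \<in> B}"
  have corner: "x \<in> corner_simplex (q - 1)"
    if "add_last_coord q x \<in> prob_simplex q" "x \<in> extensional {..<q - 1}" for x
  proof -
    have nonneg: "0 \<le> add_last_coord q x i" if "i < q" for i
      using \<open>add_last_coord q x \<in> prob_simplex q\<close> that by (simp add: prob_simplex_def)
    have "0 \<le> x i" if "i < q - 1" for i
      using nonneg[of i] that by (simp add: add_last_coord_def)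
    moreover have "(\<Sum>i<q - 1. x i) \<le> 1"
      using nonneg[of "q - 1"] e by (simp add: add_last_coord_def)
    ultimately show ?thesis using that(2) by (simp add: corner_simplex_def PiE_iff)
  qed
  have "ennreal (w * (\<Prod>i\<in>?I. u i - l i)) \<le> emeasure (\<Pi>\<^sub>M i\<in>insert e ?I. (lborel :: real measure)) ?A"
  proof (rule emeasure_PiM_ge_slices[OF _ _ _ lu])
    show "?A \<in> sets (Pi\<^sub>M (insert e ?I) (\<lambda>i. lborel))" unfolding I by (rule simplex_coords_sets[OF B])
    fix x assume x: "x \<in> (\<Pi>\<^sub>E i\<in>?I. {l i..u i})"
    then have "x(e := y) \<in> extensional {..<q - 1}" for y
      using e by (auto simp: PiE_iff extensional_def)
    then show "\<exists>z. \<forall>y\<in>{z..z + w}. x(e := y) \<in> ?A" using thick[OF x] sub corner by blast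
  qed (use w in auto)
  then have "ennreal (fact (q - 1)) * ennreal (w * (\<Prod>i\<in>?I. u i - l i)) \<le> emeasure (simplex_measure q) B"
    unfolding emeasure_simplex_measure[OF B] I by (rule mult_left_mono) simp
  then have "ennreal (fact (q - 1) * (w * (\<Prod>i\<in>?I. u i - l i))) \<le> emeasure (simplex_measure q) B"
    using w lu by (subst ennreal_mult) (auto intro!: mult_nonneg_nonneg prod_nonneg)
  then show ?thesis
    using w lu by (simp add: emeasure_eq_measure mult_nonneg_nonneg prod_nonneg)
qed

lemma sets_prob_simplex: "prob_simplex q \<in> sets (\<Pi>\<^sub>M a\<in>{..<q}. borel)"
proof -
  have "prob_simplex q = {\<mu> \<in> space (\<Pi>\<^sub>M a\<in>{..<q}. borel).
      (\<forall>a\<in>{..<q}. 0 \<le> \<mu> a) \<and> (\<Sum>a<q. \<mu> a) = 1}"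
    by (auto simp: prob_simplex_def space_PiM)
  also have "\<dots> \<in> sets (\<Pi>\<^sub>M a\<in>{..<q}. borel)"
    by measurable
  finally show ?thesis .
qed

lemma sets_prob_simplex_Collect:
  assumes "{\<mu> \<in> space (\<Pi>\<^sub>M a\<in>{..<q}. borel). P \<mu>} \<in> sets (\<Pi>\<^sub>M a\<in>{..<q}. (borel :: real measure))"
  shows "{\<mu> \<in> prob_simplex q. P \<mu>} \<in> sets (\<Pi>\<^sub>M a\<in>{..<q}. borel)"
proof -
  have "{\<mu> \<in> prob_simplex q. P \<mu>} = prob_simplex q \<inter> {\<mu> \<in> space (\<Pi>\<^sub>M a\<in>{..<q}. borel). P \<mu>}"
    using sets.sets_into_space[OF sets_prob_simplex[of q]] by auto
  then show ?thesis using assms sets_prob_simplex by auto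
qed

definition coord_band :: "nat \<Rightarrow> nat \<Rightarrow> real \<Rightarrow> real \<Rightarrow> (nat \<Rightarrow> real) set" where
  "coord_band q b t w = {\<mu> \<in> prob_simplex q. \<bar>\<mu> b - t\<bar> \<le> w}"

definition tie_band :: "nat \<Rightarrow> nat \<Rightarrow> nat \<Rightarrow> real \<Rightarrow> (nat \<Rightarrow> real) set" where
  "tie_band q b c w = {\<mu> \<in> prob_simplex q. \<bar>\<mu> b - \<mu> c\<bar> \<le> w}"

lemma sets_coord_band [measurable]:
  assumes "b < q"
  shows "coord_band q b t w \<in> sets (\<Pi>\<^sub>M a\<in>{..<q}. borel)"
proof -
  have [measurable]: "b \<in> {..<q}" using assms by simp
  show ?thesis unfolding coord_band_def by (rule sets_prob_simplex_Collect) measurable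
qed

lemma sets_tie_band [measurable]:
  assumes "b < q" "c < q"
  shows "tie_band q b c w \<in> sets (\<Pi>\<^sub>M a\<in>{..<q}. borel)"
proof -
  have [measurable]: "b \<in> {..<q}" "c \<in> {..<q}" using assms by auto
  show ?thesis unfolding tie_band_def by (rule sets_prob_simplex_Collect) measurable
qed

text \<open>
  Every band contains a direction between a letter and the last one in which it is thin; which one
  depends on whether the letter is itself the last.
\<close>

lemma measure_coord_band_le:
  assumes q: "q \<ge> 2" and b: "b < q" and w: "0 \<le> w"
  shows "measure (simplex_measure q) (coord_band q b t w) \<le> fact (q - 1) * (4 * w)"
proof -
  define e where "e = (if b < q - 1 then b else 0)"
  have "measure (simplex_measure q) (coord_band q b t w)
      \<le> fact (q - 1) * (2 * (2 * w) * (\<Prod>i\<in>{..<q - 1} - {e}. (\<lambda>_. 1) i - (\<lambda>_. 0) i))"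
  proof (rule measure_simplex_le_slices)
    show "e < q - 1" using q by (auto simp: e_def)
    show "\<mu> i \<in> {0..1}" if "\<mu> \<in> prob_simplex q" "i < q - 1" for \<mu> i
      using that member_le_sum[of i "{..<q}" \<mu>] by (auto simp: prob_simplex_def)
    show "\<bar>\<mu> e - \<nu> e\<bar> \<le> 2 * w"
      if "\<mu> \<in> coord_band q b t w" "\<nu> \<in> coord_band q b t w"
        "\<mu> e + \<mu> (q - 1) = \<nu> e + \<nu> (q - 1)" for \<mu> \<nu>
    proof (cases "b < q - 1")
      case True
      with that show ?thesis by (auto simp: e_def coord_band_def)
    next
      case False
      then have "b = q - 1" using b by simp
      with that show ?thesis by (auto simp: coord_band_def abs_le_iff)
    qed
  qed (use b w in auto)
  then show ?thesis by simp
qed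

lemma measure_tie_band_le:
  assumes q: "q \<ge> 2" and bc: "b < c" "c < q" and w: "0 \<le> w"
  shows "measure (simplex_measure q) (tie_band q b c w) \<le> fact (q - 1) * (4 * w)"
proof -
  have "measure (simplex_measure q) (tie_band q b c w)
      \<le> fact (q - 1) * (2 * (2 * w) * (\<Prod>i\<in>{..<q - 1} - {b}. (\<lambda>_. 1) i - (\<lambda>_. 0) i))"
  proof (rule measure_simplex_le_slices)
    show "b < q - 1" using bc by auto
    show "\<mu> i \<in> {0..1}" if "\<mu> \<in> prob_simplex q" "i < q - 1" for \<mu> i
      using that member_le_sum[of i "{..<q}" \<mu>] by (auto simp: prob_simplex_def)
    show "\<bar>\<mu> b - \<nu> b\<bar> \<le> 2 * w"
      if "\<mu> \<in> tie_band q b c w" "\<nu> \<in> tie_band q b c w" "\<And>i. i < q - 1 \<Longrightarrow> i \<noteq> b \<Longrightarrow> \<mu> i = \<nu> i"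
        "\<mu> b + \<mu> (q - 1) = \<nu> b + \<nu> (q - 1)" for \<mu> \<nu>
    proof (cases "c < q - 1")
      case True
      with that(1,2) that(3)[of c] bc show ?thesis by (auto simp: tie_band_def)
    next
      case False
      then have "c = q - 1" using bc by simp
      with that show ?thesis by (auto simp: tie_band_def abs_le_iff)
    qed
  qed (use bc w in auto)
  then show ?thesis by simp
qed

text \<open>
  For \<open>q = 2\<close> two coordinates cannot both be close to \<open>t > 1/2\<close>. For \<open>q \<ge> 3\<close> the set is thin in
  the direction of \<open>b\<close> and in a second direction.
\<close>

lemma measure_two_coord_bands_le:
  assumes q: "q \<ge> 2" and bc: "b < c" "c < q" and w: "0 \<le> w" and small: "q = 2 \<Longrightarrow> w < t - 1 / 2"
  shows "measure (simplex_measure q) (coord_band q b t w \<inter> coord_band q c t w) \<le> fact (q - 1) * (8 * w\<^sup>2)"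
proof (cases "q = 2")
  case True
  then have b: "b = 0" "c = 1" using bc by auto
  have False if "\<mu> \<in> coord_band q b t w \<inter> coord_band q c t w" for \<mu>
  proof -
    have "\<mu> 0 + \<mu> 1 = 1" using that True by (simp add: coord_band_def prob_simplex_def numeral_2_eq_2)
    then show False using that b small[OF True] by (auto simp: coord_band_def abs_le_iff)
  qed
  then have "coord_band q b t w \<inter> coord_band q c t w = {}" by blast
  then show ?thesis by simp
next
  case False
  obtain e where e: "e < q - 1" "e \<noteq> b" "c < q - 1 \<Longrightarrow> e = c"
  proof (cases "c < q - 1")
    case True
    then show ?thesis using that[of c] bc by auto
  next
    case c: False
    show ?thesis by (rule that[of "if b = 0 then 1 else 0"]) (use c bc False q in auto)
  qed
  have "measure (simplex_measure q) (coord_band q b t w \<inter> coord_band q c t w)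
      \<le> fact (q - 1) * (2 * (2 * w) * (\<Prod>i\<in>{..<q - 1} - {e}.
          (if i = b then t + w else 1) - (if i = b then t - w else 0)))"
  proof (rule measure_simplex_le_slices[OF e(1)])
    show "\<mu> i \<in> {if i = b then t - w else 0..if i = b then t + w else 1}"
      if "\<mu> \<in> prob_simplex q" "\<mu> \<in> coord_band q b t w \<inter> coord_band q c t w" "i < q - 1" for \<mu> i
      using that member_le_sum[of i "{..<q}" \<mu>]
      by (auto simp: prob_simplex_def coord_band_def abs_le_iff)
    show "\<bar>\<mu> e - \<nu> e\<bar> \<le> 2 * w"
      if "\<mu> \<in> coord_band q b t w \<inter> coord_band q c t w" "\<nu> \<in> coord_band q b t w \<inter> coord_band q c t w"
        "\<mu> e + \<mu> (q - 1) = \<nu> e + \<nu> (q - 1)" for \<mu> \<nu>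
    proof (cases "c < q - 1")
      case True
      with that e(3) show ?thesis by (auto simp: coord_band_def)
    next
      case False
      then have "c = q - 1" using bc by simp
      with that show ?thesis by (auto simp: coord_band_def abs_le_iff)
    qed
  qed (use bc w in auto)
  also have "(\<Prod>i\<in>{..<q - 1} - {e}. (if i = b then t + w else 1) - (if i = b then t - w else 0))
      = (\<Prod>i\<in>{..<q - 1} - {e}. if i = b then 2 * w else 1)"
    by (intro prod.cong) auto
  also have "\<dots> = 2 * w" using bc e by (simp add: prod.delta)
  finally show ?thesis by (simp add: power2_eq_square)
qed

text \<open>
  The choice \<open>\<rho> = 2 / (q + 1)\<close> enters here: with one coordinate at \<open>\<rho>\<close>, equal sharing of the rest
  puts every other coordinate at \<open>\<rho> / 2\<close>, well below \<open>\<rho>\<close>. The tolerance \<open>\<tau>\<close> is so small that a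
  perturbation by \<open>\<tau>\<close> in each of \<open>q\<close> coordinates changes the remaining mass by at most \<open>\<rho> / 8\<close>.
\<close>

lemma measure_single_contender_ge:
  fixes q :: nat and s t :: real
  defines "\<tau> \<equiv> 1 / (4 * real q * (real q + 1))"
  assumes q: "q \<ge> 2" and a: "a < q" and st: "s \<le> t" "2 / (real q + 1) - \<tau> \<le> s" "t \<le> 2 / (real q + 1) + \<tau>"
  shows "\<tau> ^ (q - 2) * (t - s) \<le> measure (simplex_measure q)
    {\<mu> \<in> prob_simplex q. s \<le> \<mu> a \<and> \<mu> a \<le> t \<and> (\<forall>c<q. c \<noteq> a \<longrightarrow> \<mu> c \<le> 3 / 4 * (2 / (real q + 1)))}"
    (is "_ \<le> measure _ ?B")
proof -
  define \<kappa> where "\<kappa> = 1 / (real q + 1)"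
  have "0 < 4 * real q * (real q + 1)" using q by simp
  with q have \<tau>: "0 < \<tau>" "real q * \<tau> = \<kappa> / 4" by (simp_all add: \<tau>_def \<kappa>_def)
  have \<kappa>: "2 / (real q + 1) = 2 * \<kappa>" "0 < \<kappa>" "(real q + 1) * \<kappa> = 1" by (auto simp: \<kappa>_def)
  define e where "e = (if a < q - 1 then a else 0)"
  have e: "e < q - 1" using q by (auto simp: e_def)
  let ?I = "{..<q - 1} - {e}"
  have cardI: "card ?I = q - 2" using e by simp
  have "fact (q - 1) * ((t - s) * (\<Prod>i\<in>?I. (\<lambda>_. \<kappa> + \<tau>) i - (\<lambda>_. \<kappa>) i)) \<le> measure (simplex_measure q) ?B"
  proof (rule measure_simplex_ge_slices[OF e])
    have [measurable]: "a \<in> {..<q}" using a by simp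
    have [measurable]: "\<And>c. c \<in> {..<q} \<Longrightarrow> (\<lambda>x. x c) \<in> borel_measurable (\<Pi>\<^sub>M a\<in>{..<q}. (borel :: real measure))"
      by measurable
    have "?B = {\<mu> \<in> prob_simplex q. s \<le> \<mu> a \<and> \<mu> a \<le> t \<and> (\<forall>c\<in>{..<q}. c \<noteq> a \<longrightarrow> \<mu> c \<le> 3 / 4 * (2 / (real q + 1)))}"
      by auto
    also have "\<dots> \<in> sets (\<Pi>\<^sub>M a\<in>{..<q}. borel)"
      by (rule sets_prob_simplex_Collect) measurable
    finally show "?B \<in> sets (\<Pi>\<^sub>M a\<in>{..<q}. borel)" .
    show "?B \<subseteq> prob_simplex q" by auto
    fix x assume x: "x \<in> (\<Pi>\<^sub>E i\<in>?I. {\<kappa>..\<kappa> + \<tau>})"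
    define S where "S = (\<Sum>i\<in>?I. x i)"
    have xi: "\<kappa> \<le> x i" "x i \<le> \<kappa> + \<tau>" if "i < q - 1" "i \<noteq> e" for i
      using x that by (auto simp: PiE_iff)
    have "real (card ?I) * \<kappa> \<le> S" unfolding S_def
      by (rule sum_bounded_below) (use xi in auto)
    moreover have "S \<le> real (card ?I) * (\<kappa> + \<tau>)" unfolding S_def
      by (rule sum_bounded_above) (use xi in auto)
    moreover have "real (card ?I) = real q - 2" unfolding cardI using q by (simp add: of_nat_diff)
    ultimately have S: "(real q - 2) * \<kappa> \<le> S" "S \<le> (real q - 2) * (\<kappa> + \<tau>)"
      by simp_all
    have S': "1 - 3 * \<kappa> \<le> S" "S \<le> 1 - 3 * \<kappa> + (\<kappa> / 4 - 2 * \<tau>)"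
      using S \<kappa>(3) \<tau>(2) by (simp_all add: algebra_simps)
    have \<tau>\<kappa>: "2 * \<tau> \<le> \<kappa> / 4" using q \<tau>(1) mult_right_mono[of 2 "real q" \<tau>] unfolding \<tau>(2)[symmetric] by simp
    let ?\<nu> = "\<lambda>y. add_last_coord q (x(e := y))"
    have \<nu>: "?\<nu> y e = y" "?\<nu> y (q - 1) = 1 - S - y" "\<And>i. i < q - 1 \<Longrightarrow> i \<noteq> e \<Longrightarrow> ?\<nu> y i = x i" for y
    proof -
      have "(\<Sum>i<q - 1. (x(e := y)) i) = y + S"
        using e by (subst sum.remove[of _ e]) (auto simp: S_def intro!: sum.cong)
      then show "?\<nu> y (q - 1) = 1 - S - y" using q by (simp add: add_last_coord_def)
    qed (use e in \<open>auto simp: add_last_coord_def\<close>)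
    \<comment> \<open>If \<open>a\<close> is the last letter, its mass is controlled through that of \<open>e\<close>.\<close>
    define z where "z = (if a < q - 1 then s else 1 - S - t)"
    have "?\<nu> y \<in> ?B" if y: "y \<in> {z..z + (t - s)}" for y
    proof -
      have low: "?\<nu> y i \<ge> 0 \<and> (i \<noteq> a \<longrightarrow> ?\<nu> y i \<le> 3 / 2 * \<kappa>)" if i: "i < q" for i
      proof -
        consider "i = e" | "i = q - 1" | "i < q - 1" "i \<noteq> e" using i by linarith
        then show ?thesis
        proof cases
          case 1
          then show ?thesis using y \<nu>(1)[of y] S' \<tau> \<tau>\<kappa> st \<kappa>
            by (auto simp: z_def e_def split: if_splits)
        next
          case 2
          then show ?thesis using y \<nu>(2)[of y] S' \<tau> \<tau>\<kappa> st \<kappa> a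
            by (auto simp: z_def split: if_splits)
        next
          case 3
          then show ?thesis using \<nu>(3)[of i y] xi[of i] \<kappa> \<tau> \<tau>\<kappa> by simp
        qed
      qed
      have "(\<Sum>i<q. ?\<nu> y i) = 1"
      proof -
        have "{..<q} = insert (q - 1) {..<q - 1}" using e by auto
        then have "(\<Sum>i<q. ?\<nu> y i) = ?\<nu> y (q - 1) + (\<Sum>i<q - 1. ?\<nu> y i)" by simp
        also have "(\<Sum>i<q - 1. ?\<nu> y i) = ?\<nu> y e + (\<Sum>i\<in>?I. ?\<nu> y i)"
          using e by (intro sum.remove) auto
        also have "(\<Sum>i\<in>?I. ?\<nu> y i) = S" unfolding S_def by (intro sum.cong) (use \<nu>(3) in auto)
        also have "?\<nu> y (q - 1) + (?\<nu> y e + S) = 1" using \<nu>(1)[of y] \<nu>(2)[of y] by linarith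
        finally show ?thesis .
      qed
      moreover have "?\<nu> y \<in> {..<q} \<rightarrow>\<^sub>E UNIV" by (simp add: add_last_coord_def)
      moreover have "s \<le> ?\<nu> y a \<and> ?\<nu> y a \<le> t"
      proof (cases "a < q - 1")
        case True
        then show ?thesis using y \<nu>(1)[of y] by (simp add: z_def e_def)
      next
        case False
        then have "a = q - 1" using a by simp
        with False show ?thesis using y \<nu>(2)[of y] by (simp add: z_def)
      qed
      ultimately show ?thesis using low \<kappa>(1) by (simp add: prob_simplex_def)
    qed
    then show "\<exists>z. \<forall>y\<in>{z..z + (t - s)}. ?\<nu> y \<in> ?B" by blast
  qed (use st \<tau> in auto)
  then have "fact (q - 1) * ((t - s) * \<tau> ^ (q - 2)) \<le> measure (simplex_measure q) ?B"
    by (simp only: add_diff_cancel_left' prod_constant cardI)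
  moreover have "(t - s) * \<tau> ^ (q - 2) \<le> fact (q - 1) * ((t - s) * \<tau> ^ (q - 2))"
    using st \<tau> mult_right_mono[of 1 "fact (q - 1)" "(t - s) * \<tau> ^ (q - 2)"] by simp
  ultimately show ?thesis by (simp add: mult.commute)
qed


section \<open>Measure of the undecided set\<close>

lemma measurable_tribes_prob:
  "(\<lambda>\<mu>. tribes_prob q m r T \<mu> a) \<in> borel_measurable (\<Pi>\<^sub>M a\<in>{..<q}. borel)"
  unfolding tribes_prob_def word_exp_def
proof (intro borel_measurable_sum borel_measurable_times borel_measurable_prod borel_measurable_const)
  fix x i assume "x \<in> words q (m * r)" "i \<in> {1..m * r}"
  then have "x i \<in> {..<q}" by (auto simp: PiE_iff)
  then show "(\<lambda>\<mu>. \<mu> (x i)) \<in> borel_measurable (\<Pi>\<^sub>M a\<in>{..<q}. (borel :: real measure))"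
    by measurable
qed

definition undecided :: "nat \<Rightarrow> nat \<Rightarrow> nat \<Rightarrow> (nat \<Rightarrow> nat set) \<Rightarrow> real \<Rightarrow> nat \<Rightarrow> (nat \<Rightarrow> real) set" where
  "undecided q m r T \<epsilon> a = {\<mu> \<in> prob_simplex q.
     \<epsilon> \<le> tribes_prob q m r T \<mu> a \<and> tribes_prob q m r T \<mu> a \<le> 1 - \<epsilon>}"

lemma sets_undecided: "undecided q m r T \<epsilon> a \<in> sets (\<Pi>\<^sub>M a\<in>{..<q}. borel)"
proof -
  note [measurable] = measurable_tribes_prob
  show ?thesis unfolding undecided_def by (rule sets_prob_simplex_Collect) measurable
qed

text \<open>
  The points of the simplex where the outcome may fail to be nearly deterministic: some letter lies in
  the critical window \<open>[s, t]\<close>, or two letters are nearly tied, or two letters are both near \<open>\<rho>\<close>.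
  Only the first part contributes to the leading order.
\<close>

definition exceptional :: "nat \<Rightarrow> real \<Rightarrow> real \<Rightarrow> real \<Rightarrow> real \<Rightarrow> real \<Rightarrow> (nat \<Rightarrow> real) set" where
  "exceptional q \<rho> s t \<delta> \<eta> =
     (\<Union>b\<in>{..<q}. coord_band q b ((s + t) / 2) ((t - s) / 2)) \<union>
     (\<Union>(b, c)\<in>{(b, c). b < c \<and> c < q}. tie_band q b c \<delta> \<union> (coord_band q b \<rho> \<eta> \<inter> coord_band q c \<rho> \<eta>))"

lemma sets_exceptional: "exceptional q \<rho> s t \<delta> \<eta> \<in> sets (\<Pi>\<^sub>M a\<in>{..<q}. borel)"
proof -
  have "finite {(b, c). b < c \<and> c < q}"
    by (rule finite_subset[of _ "{..<q} \<times> {..<q}"]) auto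
  then show ?thesis
    unfolding exceptional_def
    by (intro sets.Un sets.finite_UN) (auto intro!: sets_coord_band sets_tie_band)
qed

lemma measure_exceptional_le:
  assumes q: "q \<ge> 2" and "s \<le> t" "0 \<le> \<delta>" "0 \<le> \<eta>" "q = 2 \<Longrightarrow> \<eta> < \<rho> - 1 / 2"
  shows "measure (simplex_measure q) (exceptional q \<rho> s t \<delta> \<eta>)
    \<le> fact (q - 1) * (2 * real q * (t - s) + (real q)\<^sup>2 * (4 * \<delta> + 8 * \<eta>\<^sup>2))"
proof -
  let ?\<gamma> = "measure (simplex_measure q)"
  let ?P = "{(b, c). b < c \<and> c < q}"
  let ?X = "\<lambda>b. coord_band q b ((s + t) / 2) ((t - s) / 2)"
  let ?Y = "\<lambda>(b, c). tie_band q b c \<delta> \<union> (coord_band q b \<rho> \<eta> \<inter> coord_band q c \<rho> \<eta>)"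
  have P: "?P \<subseteq> {..<q} \<times> {..<q}" by auto
  then have finP: "finite ?P" by (rule finite_subset) simp
  have "card ?P \<le> q\<^sup>2" using card_mono[OF _ P] by (simp add: power2_eq_square)
  then have cardP: "real (card ?P) \<le> (real q)\<^sup>2" by (metis of_nat_le_iff of_nat_power)
  have setsX: "?X b \<in> sets (simplex_measure q)" if "b \<in> {..<q}" for b
    using that by (simp add: sets_simplex_measure sets_coord_band)
  have setsY: "?Y p \<in> sets (simplex_measure q)" if "p \<in> ?P" for p
    using that by (auto simp: sets_simplex_measure intro!: sets_coord_band sets_tie_band)
  have "?\<gamma> (\<Union>b\<in>{..<q}. ?X b) \<le> (\<Sum>b<q. ?\<gamma> (?X b))"
    using setsX by (intro measure_UNION_le) auto
  also have "\<dots> \<le> real (card {..<q}) * (fact (q - 1) * (4 * ((t - s) / 2)))"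
    using assms by (intro sum_bounded_above measure_coord_band_le) auto
  finally have X: "?\<gamma> (\<Union>b\<in>{..<q}. ?X b) \<le> fact (q - 1) * (2 * real q * (t - s))"
    by (simp add: algebra_simps)
  have "?\<gamma> (\<Union>p\<in>?P. ?Y p) \<le> (\<Sum>p\<in>?P. ?\<gamma> (?Y p))"
    using setsY finP by (intro measure_UNION_le) auto
  also have "\<dots> \<le> real (card ?P) * (fact (q - 1) * (4 * \<delta> + 8 * \<eta>\<^sup>2))"
  proof (rule sum_bounded_above)
    fix p assume "p \<in> ?P"
    then obtain b c where p: "p = (b, c)" "b < c" "c < q" by auto
    have "?\<gamma> (?Y p) \<le> ?\<gamma> (tie_band q b c \<delta>) + ?\<gamma> (coord_band q b \<rho> \<eta> \<inter> coord_band q c \<rho> \<eta>)"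
      unfolding p(1) prod.case using p
      by (intro measure_Un_le) (auto simp: sets_simplex_measure intro!: sets_coord_band sets_tie_band)
    also have "\<dots> \<le> fact (q - 1) * (4 * \<delta>) + fact (q - 1) * (8 * \<eta>\<^sup>2)"
      using p assms by (intro add_mono measure_tie_band_le measure_two_coord_bands_le) auto
    finally show "?\<gamma> (?Y p) \<le> fact (q - 1) * (4 * \<delta> + 8 * \<eta>\<^sup>2)" by (simp add: algebra_simps)
  qed
  also have "\<dots> \<le> (real q)\<^sup>2 * (fact (q - 1) * (4 * \<delta> + 8 * \<eta>\<^sup>2))"
    using cardP assms by (intro mult_right_mono) auto
  finally have Y: "?\<gamma> (\<Union>p\<in>?P. ?Y p) \<le> fact (q - 1) * ((real q)\<^sup>2 * (4 * \<delta> + 8 * \<eta>\<^sup>2))"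
    by (simp add: algebra_simps)
  have "?\<gamma> (exceptional q \<rho> s t \<delta> \<eta>) \<le> ?\<gamma> (\<Union>b\<in>{..<q}. ?X b) + ?\<gamma> (\<Union>p\<in>?P. ?Y p)"
    unfolding exceptional_def using setsX setsY finP
    by (intro measure_Un_le sets.finite_UN) auto
  with X Y show ?thesis by (simp add: algebra_simps)
qed

text \<open>
  Consider the most likely letter \<open>b\<close>. If it lies above \<open>\<rho> + \<eta>\<close>, it wins, being ahead of the others
  by \<open>\<delta>\<close>. If no letter but \<open>0\<close> reaches \<open>\<rho> - \<eta>\<close>, the default \<open>0\<close> wins. Otherwise exactly one letter
  \<open>c\<close>, different from \<open>0\<close>, is near \<open>\<rho>\<close>, and as it lies outside the window it either almost surely
  has a unanimous block and wins, or almost surely has none and loses to \<open>0\<close>.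
\<close>

lemma decided_outside_exceptional:
  fixes \<rho> s t \<delta> \<eta> \<epsilon> :: real
  assumes q: "q \<ge> 2" and \<mu>: "\<mu> \<in> prob_simplex q" and part: "tribes_partition m r T" and r: "r \<ge> 1"
    and out: "\<mu> \<notin> exceptional q \<rho> s t \<delta> \<eta>"
    and \<rho>: "0 < \<rho>" "\<rho> \<le> 1" and \<delta>: "0 \<le> \<delta>" "\<delta> \<le> 1" and \<eta>: "0 \<le> \<eta>"
    and m: "m * \<rho> ^ r \<le> 1" "1 / 2 \<le> m * \<rho> ^ r" and st: "0 \<le> s" "s ^ r \<le> 1" "0 \<le> t"
    and sub: "q * (1 - \<eta>) ^ r < \<epsilon>"
    and super: "q * exp (- ((1 + \<eta>) ^ r * \<delta>\<^sup>2 / 8)) < \<epsilon>"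
    and above: "1 - \<epsilon> < 1 - (1 - t ^ r) ^ m - q * (1 - \<eta>) ^ r"
    and below: "1 - \<epsilon> < (1 - s ^ r) ^ m - q * (1 - \<eta>) ^ r"
  shows "\<exists>b<q. 1 - \<epsilon> < tribes_prob q m r T \<mu> b"
proof -
  let ?F = "tribes_prob q m r T \<mu>"
  have bounds: "0 \<le> \<mu> b" "\<mu> b \<le> 1" if "b < q" for b using prob_simplex_le_1[OF \<mu> that] by auto
  have tie: "\<bar>\<mu> b - \<mu> c\<bar> > \<delta>" and pair: "\<bar>\<mu> b - \<rho>\<bar> > \<eta> \<or> \<bar>\<mu> c - \<rho>\<bar> > \<eta>"
    if "b < q" "c < q" "b \<noteq> c" for b c
  proof -
    have *: "\<bar>\<mu> b - \<mu> c\<bar> > \<delta> \<and> (\<bar>\<mu> b - \<rho>\<bar> > \<eta> \<or> \<bar>\<mu> c - \<rho>\<bar> > \<eta>)" if "b < c" "c < q" for b c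
      using out \<mu> that unfolding exceptional_def tie_band_def coord_band_def by fastforce
    show "\<bar>\<mu> b - \<mu> c\<bar> > \<delta>" "\<bar>\<mu> b - \<rho>\<bar> > \<eta> \<or> \<bar>\<mu> c - \<rho>\<bar> > \<eta>"
      using *[of b c] *[of c b] that by (cases "b < c"; auto simp: abs_minus_commute)+
  qed
  have window: "\<mu> b < s \<or> t < \<mu> b" if "b < q" for b
  proof -
    have "\<mu> \<notin> coord_band q b ((s + t) / 2) ((t - s) / 2)"
      using out that unfolding exceptional_def by blast
    then have "\<not> \<bar>\<mu> b - (s + t) / 2\<bar> \<le> (t - s) / 2" using \<mu> by (simp add: coord_band_def)
    then show ?thesis by (simp add: abs_if field_simps split: if_splits)
  qed
  have low: "m * \<mu> c ^ r \<le> (1 - \<eta>) ^ r" and \<eta>1: "\<eta> \<le> 1" if "c < q" "\<mu> c \<le> \<rho> - \<eta>" for c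
  proof -
    have "\<rho> * \<eta> \<le> \<eta>" using \<rho> \<eta> by (simp add: mult_left_le_one_le)
    then have le: "\<mu> c \<le> \<rho> * (1 - \<eta>)" using that by (simp add: algebra_simps)
    with bounds[OF that(1)] \<rho> show "\<eta> \<le> 1" by (smt (verit) mult_pos_neg)
    have "m * \<mu> c ^ r \<le> m * (\<rho> * (1 - \<eta>)) ^ r"
      using le bounds[OF that(1)] by (intro mult_left_mono power_mono) auto
    also have "\<dots> = (m * \<rho> ^ r) * (1 - \<eta>) ^ r" by (simp add: power_mult_distrib)
    also have "\<dots> \<le> 1 * (1 - \<eta>) ^ r"
      using m \<open>\<eta> \<le> 1\<close> by (intro mult_right_mono) auto
    finally show "m * \<mu> c ^ r \<le> (1 - \<eta>) ^ r" by simp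
  qed
  have "\<mu> ` {..<q} \<noteq> {}" using q by (auto simp: lessThan_empty_iff)
  then have "Max (\<mu> ` {..<q}) \<in> \<mu> ` {..<q}" by (intro Max_in) auto
  then obtain b where "b < q" "\<mu> b = Max (\<mu> ` {..<q})" by auto
  then have b: "b < q" "\<And>c. c < q \<Longrightarrow> \<mu> c \<le> \<mu> b" by auto
  show ?thesis
  proof (cases "\<rho> + \<eta> \<le> \<mu> b")
    case True
    have "1 / 2 * (1 + \<eta>) ^ r \<le> (m * \<rho> ^ r) * (1 + \<eta>) ^ r"
      using m \<eta> by (intro mult_right_mono) auto
    also have "\<dots> = m * (\<rho> * (1 + \<eta>)) ^ r" by (simp add: power_mult_distrib)
    also have "\<dots> \<le> m * \<mu> b ^ r"
    proof (intro mult_left_mono power_mono)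
      have "\<rho> * \<eta> \<le> \<eta>" using \<rho> \<eta> by (simp add: mult_left_le_one_le)
      then show "\<rho> * (1 + \<eta>) \<le> \<mu> b" using True by (simp add: algebra_simps)
    qed (use \<rho> \<eta> in auto)
    finally have "1 / 2 * (1 + \<eta>) ^ r * (\<delta>\<^sup>2 / 4) \<le> m * \<mu> b ^ r * (\<delta>\<^sup>2 / 4)"
      by (rule mult_right_mono) simp
    then have "exp (- (m * \<mu> b ^ r * \<delta>\<^sup>2 / 4)) \<le> exp (- ((1 + \<eta>) ^ r * \<delta>\<^sup>2 / 8))"
      by simp
    then have "q * exp (- (m * \<mu> b ^ r * \<delta>\<^sup>2 / 4)) \<le> q * exp (- ((1 + \<eta>) ^ r * \<delta>\<^sup>2 / 8))"
      by (rule mult_left_mono) simp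
    moreover have "1 - q * exp (- (m * \<mu> b ^ r * \<delta>\<^sup>2 / 4)) \<le> ?F b"
    proof (rule tribes_prob_ge_dominant[OF q \<mu> part b(1) r \<delta>])
      fix c assume "c < q" "c \<noteq> b"
      then show "\<mu> c \<le> \<mu> b - \<delta>" using tie[of c b] b by fastforce
    qed
    ultimately have "1 - \<epsilon> < ?F b" using super by linarith
    with b show ?thesis by blast
  next
    case False
    then have small: "\<mu> c < \<rho> + \<eta>" if "c < q" for c using b(2)[OF that] by linarith
    show ?thesis
    proof (cases "\<forall>c<q. c \<noteq> 0 \<longrightarrow> \<mu> c \<le> \<rho> - \<eta>")
      case True
      then have "\<eta> \<le> 1" using \<eta>1[of 1] q by simp
      then have "1 - q * (1 - \<eta>) ^ r \<le> ?F 0"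
        using True low by (intro tribes_prob_0_ge_all[OF q \<mu> part]) auto
      with sub q show ?thesis by (intro exI[of _ 0]) auto
    next
      case False
      then obtain c where c: "c < q" "c \<noteq> 0" "\<rho> - \<eta> < \<mu> c" by fastforce
      have others: "\<mu> d \<le> \<rho> - \<eta>" if "d < q" "d \<noteq> c" for d
        using pair[of c d] small[of c] small[of d] c that by (auto simp: abs_if split: if_splits)
      have "\<eta> \<le> 1" using \<eta>1[of 0] others[of 0] c q by simp
      then have e: "0 \<le> (1 - \<eta>) ^ r" by simp
      have p: "0 \<le> \<mu> c ^ r" "\<mu> c ^ r \<le> 1" using bounds[OF c(1)] by (auto simp: power_le_one)
      from window[OF c(1)] show ?thesis
      proof
        assume "\<mu> c < s"
        then have "\<mu> c ^ r \<le> s ^ r" using bounds[OF c(1)] by (intro power_mono) auto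
        then have "(1 - s ^ r) ^ m \<le> (1 - \<mu> c ^ r) ^ m" using st by (intro power_mono) auto
        moreover have "(1 - \<mu> c ^ r) ^ m - q * (1 - \<eta>) ^ r \<le> ?F 0"
          using others low e by (intro tribes_prob_0_ge[OF q \<mu> part c(1)]) auto
        ultimately have "1 - \<epsilon> < ?F 0" using below by linarith
        then show ?thesis using q by (intro exI[of _ 0]) auto
      next
        assume "t < \<mu> c"
        then have "t ^ r \<le> \<mu> c ^ r" using st by (intro power_mono) auto
        then have "(1 - \<mu> c ^ r) ^ m \<le> (1 - t ^ r) ^ m" using p by (intro power_mono) auto
        moreover have "1 - (1 - \<mu> c ^ r) ^ m - q * (1 - \<eta>) ^ r \<le> ?F c"
          using others low e by (intro tribes_prob_ge_vote[OF q \<mu> part c(1)]) auto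
        ultimately have "1 - \<epsilon> < ?F c" using above by linarith
        then show ?thesis using c by blast
      qed
    qed
  qed
qed

lemma undecided_subset_exceptional:
  assumes q: "q \<ge> 2" and part: "tribes_partition m r T" and a: "a < q"
    and decided: "\<And>\<mu>. \<mu> \<in> prob_simplex q \<Longrightarrow> \<mu> \<notin> E \<Longrightarrow> \<exists>b<q. 1 - \<epsilon> < tribes_prob q m r T \<mu> b"
  shows "undecided q m r T \<epsilon> a \<subseteq> E"
proof (rule subsetI, rule ccontr)
  fix \<mu> assume \<mu>: "\<mu> \<in> undecided q m r T \<epsilon> a" "\<mu> \<notin> E"
  then have "\<mu> \<in> prob_simplex q" by (simp add: undecided_def)
  with decided \<mu> obtain b where b: "b < q" "1 - \<epsilon> < tribes_prob q m r T \<mu> b" by blast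
  show False
  proof (cases "b = a")
    case True
    with b \<mu> show False by (simp add: undecided_def)
  next
    case False
    then have "tribes_prob q m r T \<mu> b + tribes_prob q m r T \<mu> a \<le> 1"
      using tribes_prob_add_le_1[OF q \<open>\<mu> \<in> prob_simplex q\<close> part] by blast
    with b \<mu> show False by (simp add: undecided_def)
  qed
qed

text \<open>
  With one contender \<open>b\<close> in the window and all other letters clearly below \<open>\<rho>\<close>, the outcome is \<open>b\<close>
  or the default \<open>0\<close>, each with probability at least \<open>\<epsilon>\<close>. This serves the lower bound for \<open>b\<close> and
  for \<open>0\<close> alike.
\<close>

lemma single_contender_undecided:
  fixes \<rho> s t \<epsilon> :: real
  assumes q: "q \<ge> 2" and \<mu>: "\<mu> \<in> prob_simplex q" and part: "tribes_partition m r T" and b: "b < q" "b \<noteq> 0"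
    and win: "s \<le> \<mu> b" "\<mu> b \<le> t" and others: "\<And>c. c < q \<Longrightarrow> c \<noteq> b \<Longrightarrow> \<mu> c \<le> 3 / 4 * \<rho>"
    and \<rho>: "0 < \<rho>" and m: "m * \<rho> ^ r \<le> 1" and st: "0 \<le> s" "t ^ r \<le> 1"
    and below: "\<epsilon> \<le> 1 - (1 - s ^ r) ^ m - q * (3 / 4) ^ r"
    and above: "\<epsilon> \<le> (1 - t ^ r) ^ m - q * (3 / 4) ^ r"
    and a: "a = b \<or> a = 0"
  shows "\<mu> \<in> undecided q m r T \<epsilon> a"
proof -
  let ?F = "tribes_prob q m r T \<mu>"
  have bounds: "0 \<le> \<mu> b" "\<mu> b \<le> 1" if "b < q" for b using prob_simplex_le_1[OF \<mu> that] by auto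
  have low: "m * \<mu> c ^ r \<le> (3 / 4) ^ r" if "c < q" "c \<noteq> b" for c
  proof -
    have "m * \<mu> c ^ r \<le> m * (3 / 4 * \<rho>) ^ r"
      using others[OF that] bounds[OF that(1)] by (intro mult_left_mono power_mono) auto
    also have "\<dots> = (m * \<rho> ^ r) * (3 / 4) ^ r" unfolding power_mult_distrib by simp
    also have "\<dots> \<le> 1 * (3 / 4) ^ r" using m by (intro mult_right_mono) auto
    finally show ?thesis by simp
  qed
  have "s ^ r \<le> \<mu> b ^ r" using st win by (intro power_mono) auto
  moreover have le: "\<mu> b ^ r \<le> t ^ r" using win bounds[OF b(1)] by (intro power_mono) auto
  ultimately have "(1 - \<mu> b ^ r) ^ m \<le> (1 - s ^ r) ^ m" "(1 - t ^ r) ^ m \<le> (1 - \<mu> b ^ r) ^ m"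
    using st by (auto intro!: power_mono)
  moreover have "1 - (1 - \<mu> b ^ r) ^ m - q * (3 / 4) ^ r \<le> ?F b"
    using low by (intro tribes_prob_ge_vote[OF q \<mu> part b(1)]) auto
  moreover have "?F b \<le> 1 - (1 - \<mu> b ^ r) ^ m"
    by (rule tribes_prob_le_vote[OF q \<mu> part b])
  moreover have "(1 - \<mu> b ^ r) ^ m - q * (3 / 4) ^ r \<le> ?F 0"
    using low by (intro tribes_prob_0_ge[OF q \<mu> part b(1)]) auto
  moreover have "?F b + ?F 0 \<le> 1" by (rule tribes_prob_add_le_1[OF q \<mu> part b(2)])
  moreover have "0 \<le> q * (3 / 4 :: real) ^ r" by simp
  ultimately have "\<epsilon> \<le> ?F b" "?F b \<le> 1 - \<epsilon>" "\<epsilon> \<le> ?F 0" "?F 0 \<le> 1 - \<epsilon>"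
    using below above by linarith+
  then show ?thesis using a \<mu> by (auto simp: undecided_def)
qed


section \<open>Large blocks\<close>

lemma gumbel_length_pos:
  assumes "0 < \<epsilon>" "\<epsilon> < 1 / 2"
  shows "0 < gumbel_length \<epsilon>"
proof -
  have "0 < ln ((1 - \<epsilon>) / \<epsilon>)" using assms by (simp add: ln_gt_zero_iff field_simps)
  then show ?thesis using gumbel_length_ge[OF assms] by simp
qed

lemma gumbel_quantiles:
  fixes \<epsilon> :: real
  assumes "0 < \<epsilon>" "\<epsilon> < 1 / 2"
  shows "exp (- exp (ln (- ln \<epsilon>))) = \<epsilon>" "exp (- exp (ln (- ln (1 - \<epsilon>)))) = 1 - \<epsilon>"
  using assms by (simp_all add: ln_less_zero_iff)

text \<open>
  The window is enlarged on both sides by half of the exact length. This leaves room for the error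
  terms, which vanish as \<open>r\<close> grows for fixed \<open>\<epsilon>\<close>, and costs only a constant factor, uniformly in
  \<open>\<epsilon>\<close>. The constant 8 is the product of the 2 in \<open>measure_exceptional_le\<close>, the 2 from the enlargement
  and the 2 in \<open>gumbel_length_le\<close>. The lower bound shrinks the window in the same manner.
\<close>

lemma undecided_upper:
  assumes q: "q \<ge> 2" and \<epsilon>: "0 < \<epsilon>" "\<epsilon> < 1 / 2"
    and K: "8 * real q * fact (q - 1) * tribes_rho q * ln ((1 - \<epsilon>) / \<epsilon>) < K"
  shows "\<forall>\<^sub>F r in sequentially. \<forall>T. tribes_partition (tribes_m q r) r T \<longrightarrow> (\<forall>a<q.
    real r * measure (simplex_measure q) (undecided q (tribes_m q r) r T \<epsilon> a) \<le> K)"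
proof -
  let ?\<rho> = "tribes_rho q" and ?L = "gumbel_length \<epsilon>" and ?m = "tribes_m q"
  note \<rho> = tribes_rho_bounds[OF q]
  define s where "s = ln (- ln (1 - \<epsilon>)) - ?L / 2"
  define t where "t = ln (- ln \<epsilon>) + ?L / 2"
  have L: "0 < ?L" by (rule gumbel_length_pos[OF \<epsilon>])
  have ts: "t - s = 2 * ?L" by (simp add: s_def t_def gumbel_length_def)
  have "exp (- exp (ln (- ln (1 - \<epsilon>)))) < exp (- exp s)"
    unfolding exp_less_cancel_iff neg_less_iff_less using L by (simp add: s_def)
  then have s: "1 - \<epsilon> < exp (- exp s)" using gumbel_quantiles[OF \<epsilon>] by simp
  have "exp (- exp t) < exp (- exp (ln (- ln \<epsilon>)))"
    unfolding exp_less_cancel_iff neg_less_iff_less using L by (simp add: t_def)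
  then have t: "exp (- exp t) < \<epsilon>" using gumbel_quantiles[OF \<epsilon>] by simp
  let ?S = "window_point q s" and ?T = "window_point q t"
  define \<eta> where "\<eta> r = real r powr (- 2 / 3)" for r :: nat
  define \<delta> where "\<delta> r = 1 / real r ^ 2" for r :: nat
  have sub: "(\<lambda>r. real q * (1 - \<eta> r) ^ r) \<longlonglongrightarrow> 0"
    using tendsto_mult_left[OF subcritical_tendsto, of "real q"] by (simp add: \<eta>_def)
  have super: "(\<lambda>r. real q * exp (- ((1 + \<eta> r) ^ r * (\<delta> r)\<^sup>2 / 8))) \<longlonglongrightarrow> 0"
    using tendsto_mult_left[OF supercritical_tendsto, of "real q"] by (simp add: \<eta>_def \<delta>_def)
  have \<eta>0: "\<eta> \<longlonglongrightarrow> 0" unfolding \<eta>_def[abs_def] by real_asymp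
  have above: "(\<lambda>r. 1 - (1 - ?T r ^ r) ^ ?m r - q * (1 - \<eta> r) ^ r) \<longlonglongrightarrow> 1 - exp (- exp t) - 0"
    by (intro tendsto_diff tendsto_const no_votes_tendsto[OF q] sub)
  have below: "(\<lambda>r. (1 - ?S r ^ r) ^ ?m r - q * (1 - \<eta> r) ^ r) \<longlonglongrightarrow> exp (- exp s) - 0"
    by (intro tendsto_diff no_votes_tendsto[OF q] sub)
  have S0: "(\<lambda>r. ?\<rho> ^ r * exp s) \<longlonglongrightarrow> 0"
    using tendsto_mult_right[OF tribes_rho_power_tendsto[OF q], of "exp s"] by simp
  let ?V = "\<lambda>r. fact (q - 1) * (2 * real q * (?T r - ?S r) + (real q)\<^sup>2 * (4 * \<delta> r + 8 * (\<eta> r)\<^sup>2)) :: real"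
  have "(\<lambda>r. fact (q - 1) * (2 * real q * (real r * (?T r - ?S r)) + (real q)\<^sup>2 * (real r * (4 * \<delta> r + 8 * (\<eta> r)\<^sup>2))))
      \<longlonglongrightarrow> fact (q - 1) * (2 * real q * (?\<rho> * (t - s)) + (real q)\<^sup>2 * 0)"
  proof -
    have "(\<lambda>r. real r * (4 * \<delta> r + 8 * (\<eta> r)\<^sup>2)) \<longlonglongrightarrow> 0"
      unfolding \<delta>_def \<eta>_def by real_asymp
    from tendsto_mult[OF tendsto_const tendsto_add[OF tendsto_mult[OF tendsto_const window_width_tendsto]
        tendsto_mult[OF tendsto_const this]]]
    show ?thesis .
  qed
  moreover have "fact (q - 1) * (2 * real q * (?\<rho> * (t - s)) + (real q)\<^sup>2 * 0) < K"
  proof -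
    have "fact (q - 1) * (2 * real q * (?\<rho> * (t - s)) + (real q)\<^sup>2 * 0) = (4 * real q * fact (q - 1) * ?\<rho>) * ?L"
      by (simp add: ts)
    also have "\<dots> \<le> (4 * real q * fact (q - 1) * ?\<rho>) * (2 * ln ((1 - \<epsilon>) / \<epsilon>))"
      using \<rho> gumbel_length_le[OF \<epsilon>] by (intro mult_left_mono) auto
    finally show ?thesis using K by (simp add: mult_ac)
  qed
  ultimately have "\<forall>\<^sub>F r in sequentially.
      fact (q - 1) * (2 * real q * (real r * (?T r - ?S r)) + (real q)\<^sup>2 * (real r * (4 * \<delta> r + 8 * (\<eta> r)\<^sup>2))) < K"
    by (rule order_tendstoD(2))
  then have V: "\<forall>\<^sub>F r in sequentially. real r * ?V r < K"
    by (rule eventually_mono) (simp add: algebra_simps)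
  have half: "\<forall>\<^sub>F r in sequentially. 1 / 2 < real (?m r) * ?\<rho> ^ r"
    by (rule order_tendstoD(1)[OF tribes_m_tendsto[OF q]]) simp
  have sub': "\<forall>\<^sub>F r in sequentially. real q * (1 - \<eta> r) ^ r < \<epsilon>"
    by (rule order_tendstoD(2)[OF sub]) (rule \<epsilon>)
  have super': "\<forall>\<^sub>F r in sequentially. real q * exp (- ((1 + \<eta> r) ^ r * (\<delta> r)\<^sup>2 / 8)) < \<epsilon>"
    by (rule order_tendstoD(2)[OF super]) (rule \<epsilon>)
  have above': "\<forall>\<^sub>F r in sequentially. 1 - \<epsilon> < 1 - (1 - ?T r ^ r) ^ ?m r - q * (1 - \<eta> r) ^ r"
    by (rule order_tendstoD(1)[OF above]) (use t in simp)
  have below': "\<forall>\<^sub>F r in sequentially. 1 - \<epsilon> < (1 - ?S r ^ r) ^ ?m r - q * (1 - \<eta> r) ^ r"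
    by (rule order_tendstoD(1)[OF below]) (use s in simp)
  have \<eta>': "\<forall>\<^sub>F r in sequentially. \<eta> r < 1 / 6"
    by (rule order_tendstoD(2)[OF \<eta>0]) simp
  have S': "\<forall>\<^sub>F r in sequentially. ?\<rho> ^ r * exp s < 1"
    by (rule order_tendstoD(2)[OF S0]) simp
  show ?thesis
    using V half sub' super' above' below' \<eta>' S' eventually_ge_at_top[of 1]
  proof eventually_elim
    case (elim r)
    show ?case
    proof (intro allI impI)
      fix T a assume part: "tribes_partition (?m r) r T" and a: "a < q"
      let ?E = "exceptional q ?\<rho> (?S r) (?T r) (\<delta> r) (\<eta> r)"
      have r: "r \<ge> 1" by (rule elim)
      have "\<exists>b<q. 1 - \<epsilon> < tribes_prob q (?m r) r T \<mu> b" if "\<mu> \<in> prob_simplex q" "\<mu> \<notin> ?E" for \<mu>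
      proof (rule decided_outside_exceptional[OF q that(1) part r that(2)])
        show "?S r ^ r \<le> 1" using elim(8) by (simp add: window_point_power[OF r])
        show "\<delta> r \<le> 1" "0 \<le> \<delta> r" using r by (simp_all add: \<delta>_def)
        show "0 \<le> \<eta> r" by (simp add: \<eta>_def)
        show "0 \<le> ?S r" "0 \<le> ?T r" using \<rho> by (simp_all add: window_point_def)
      qed (use elim \<rho> tribes_m_bounds(1)[OF q, of r] in auto)
      then have "undecided q (?m r) r T \<epsilon> a \<subseteq> ?E"
        by (intro undecided_subset_exceptional[OF q part a])
      then have "measure (simplex_measure q) (undecided q (?m r) r T \<epsilon> a) \<le> measure (simplex_measure q) ?E"
        using prob_space.finite_measure[OF prob_space_simplex_measure]
        by (intro finite_measure.finite_measure_mono) (auto simp: sets_simplex_measure sets_exceptional)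
      also have "\<dots> \<le> ?V r"
      proof (rule measure_exceptional_le[OF q])
        have "s \<le> t" using ts L by simp
        then show "?S r \<le> ?T r" using \<rho> by (simp add: window_point_def divide_right_mono)
        show "0 \<le> \<delta> r" "0 \<le> \<eta> r" by (simp_all add: \<delta>_def \<eta>_def)
        show "\<eta> r < ?\<rho> - 1 / 2" if "q = 2" using elim(7) that by (simp add: tribes_rho_def)
      qed
      finally have "real r * measure (simplex_measure q) (undecided q (?m r) r T \<epsilon> a) \<le> real r * ?V r"
        by (rule mult_left_mono) simp
      with elim(1) show "real r * measure (simplex_measure q) (undecided q (?m r) r T \<epsilon> a) \<le> K"
        by linarith
    qed
  qed
qed

lemma undecided_lower:
  fixes q :: nat
  defines "\<tau> \<equiv> 1 / (4 * real q * (real q + 1))"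
  assumes q: "q \<ge> 2" and \<epsilon>: "0 < \<epsilon>" "\<epsilon> < 1 / 2"
    and k: "k < \<tau> ^ (q - 2) * tribes_rho q * ln ((1 - \<epsilon>) / \<epsilon>) / 4"
  shows "\<forall>\<^sub>F r in sequentially. \<forall>T. tribes_partition (tribes_m q r) r T \<longrightarrow> (\<forall>a<q.
    k \<le> real r * measure (simplex_measure q) (undecided q (tribes_m q r) r T \<epsilon> a))"
proof -
  let ?\<rho> = "tribes_rho q" and ?L = "gumbel_length \<epsilon>" and ?m = "tribes_m q"
  note \<rho> = tribes_rho_bounds[OF q]
  have \<tau>: "0 < \<tau>" using q by (simp add: \<tau>_def)
  define s where "s = ln (- ln (1 - \<epsilon>)) + ?L / 4"
  define t where "t = ln (- ln \<epsilon>) - ?L / 4"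
  have L: "0 < ?L" by (rule gumbel_length_pos[OF \<epsilon>])
  have ts: "t - s = ?L / 2" by (simp add: s_def t_def gumbel_length_def field_simps)
  have "exp (- exp s) < exp (- exp (ln (- ln (1 - \<epsilon>))))"
    unfolding exp_less_cancel_iff neg_less_iff_less using L by (simp add: s_def)
  then have s: "exp (- exp s) < 1 - \<epsilon>" using gumbel_quantiles[OF \<epsilon>] by simp
  have "exp (- exp (ln (- ln \<epsilon>))) < exp (- exp t)"
    unfolding exp_less_cancel_iff neg_less_iff_less using L by (simp add: t_def)
  then have t: "\<epsilon> < exp (- exp t)" using gumbel_quantiles[OF \<epsilon>] by simp
  let ?S = "window_point q s" and ?T = "window_point q t"
  have "(\<lambda>r. (3 / 4 :: real) ^ r) \<longlonglongrightarrow> 0" by (rule LIMSEQ_power_zero) simp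
  from tendsto_mult_left[OF this, of "real q"] have sub: "(\<lambda>r. real q * (3 / 4) ^ r) \<longlonglongrightarrow> 0" by simp
  have below: "(\<lambda>r. 1 - (1 - ?S r ^ r) ^ ?m r - q * (3 / 4) ^ r) \<longlonglongrightarrow> 1 - exp (- exp s) - 0"
    by (intro tendsto_diff tendsto_const no_votes_tendsto[OF q] sub)
  have above: "(\<lambda>r. (1 - ?T r ^ r) ^ ?m r - q * (3 / 4) ^ r) \<longlonglongrightarrow> exp (- exp t) - 0"
    by (intro tendsto_diff no_votes_tendsto[OF q] sub)
  have T0: "(\<lambda>r. ?\<rho> ^ r * exp t) \<longlonglongrightarrow> 0"
    using tendsto_mult_right[OF tribes_rho_power_tendsto[OF q], of "exp t"] by simp
  have "(\<lambda>r. \<tau> ^ (q - 2) * (real r * (?T r - ?S r))) \<longlonglongrightarrow> \<tau> ^ (q - 2) * (?\<rho> * (t - s))"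
    by (intro tendsto_mult tendsto_const window_width_tendsto)
  moreover have "k < \<tau> ^ (q - 2) * (?\<rho> * (t - s))"
  proof -
    have "(\<tau> ^ (q - 2) * ?\<rho>) * (ln ((1 - \<epsilon>) / \<epsilon>) / 2) \<le> (\<tau> ^ (q - 2) * ?\<rho>) * ?L"
      using \<rho> \<tau> gumbel_length_ge[OF \<epsilon>] by (intro mult_left_mono) auto
    then show ?thesis using k by (simp add: ts algebra_simps)
  qed
  ultimately have V: "\<forall>\<^sub>F r in sequentially. k < \<tau> ^ (q - 2) * (real r * (?T r - ?S r))"
    by (rule order_tendstoD(1))
  have below': "\<forall>\<^sub>F r in sequentially. \<epsilon> < 1 - (1 - ?S r ^ r) ^ ?m r - q * (3 / 4) ^ r"
    by (rule order_tendstoD(1)[OF below]) (use s in simp)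
  have above': "\<forall>\<^sub>F r in sequentially. \<epsilon> < (1 - ?T r ^ r) ^ ?m r - q * (3 / 4) ^ r"
    by (rule order_tendstoD(1)[OF above]) (use t in simp)
  have T': "\<forall>\<^sub>F r in sequentially. ?\<rho> ^ r * exp t < 1"
    by (rule order_tendstoD(2)[OF T0]) simp
  have S\<rho>: "\<forall>\<^sub>F r in sequentially. ?\<rho> - \<tau> < ?S r"
    by (rule order_tendstoD(1)[OF window_point_tendsto]) (use \<tau> in simp)
  have T\<rho>: "\<forall>\<^sub>F r in sequentially. ?T r < ?\<rho> + \<tau>"
    by (rule order_tendstoD(2)[OF window_point_tendsto]) (use \<tau> in simp)
  show ?thesis
    using V below' above' T' S\<rho> T\<rho> eventually_ge_at_top[of 1]
  proof eventually_elim
    case (elim r)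
    show ?case
    proof (intro allI impI)
      fix T a assume part: "tribes_partition (?m r) r T" and a: "a < q"
      have r: "r \<ge> 1" by (rule elim)
      \<comment> \<open>The letter \<open>0\<close> has no window of its own; it is undecided when \<open>1\<close> is in the window.\<close>
      define b where "b = (if a = 0 then 1 else a)"
      have b: "b < q" "b \<noteq> 0" "a = b \<or> a = 0" using q a by (auto simp: b_def)
      let ?B = "{\<mu> \<in> prob_simplex q. ?S r \<le> \<mu> b \<and> \<mu> b \<le> ?T r \<and>
        (\<forall>c<q. c \<noteq> b \<longrightarrow> \<mu> c \<le> 3 / 4 * (2 / (real q + 1)))}"
      have "s \<le> t" using ts L by simp
      then have "?S r \<le> ?T r" using \<rho> by (simp add: window_point_def divide_right_mono)
      then have "\<tau> ^ (q - 2) * (?T r - ?S r) \<le> measure (simplex_measure q) ?B"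
        using elim(5,6) unfolding \<tau>_def tribes_rho_def
        by (intro measure_single_contender_ge[OF q b(1)]) auto
      also have "\<dots> \<le> measure (simplex_measure q) (undecided q (?m r) r T \<epsilon> a)"
      proof (rule finite_measure.finite_measure_mono)
        show "finite_measure (simplex_measure q)"
          by (rule prob_space.finite_measure[OF prob_space_simplex_measure])
        show "undecided q (?m r) r T \<epsilon> a \<in> sets (simplex_measure q)"
          by (simp add: sets_simplex_measure sets_undecided)
        show "?B \<subseteq> undecided q (?m r) r T \<epsilon> a"
        proof
          fix \<mu> assume \<mu>: "\<mu> \<in> ?B"
          show "\<mu> \<in> undecided q (?m r) r T \<epsilon> a"
          proof (rule single_contender_undecided[OF q _ part b(1,2) _ _ _ _ tribes_m_bounds(1)[OF q]])
            show "?T r ^ r \<le> 1" using elim(4) by (simp add: window_point_power[OF r])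
            show "0 \<le> ?S r" using \<rho> by (simp add: window_point_def)
            show "\<mu> c \<le> 3 / 4 * ?\<rho>" if "c < q" "c \<noteq> b" for c
              using \<mu> that by (simp add: tribes_rho_def)
          qed (use \<mu> \<rho> elim b(3) in auto)
        qed
      qed
      finally have "real r * (\<tau> ^ (q - 2) * (?T r - ?S r))
          \<le> real r * measure (simplex_measure q) (undecided q (?m r) r T \<epsilon> a)"
        by (rule mult_left_mono) simp
      with elim(1) show "k \<le> real r * measure (simplex_measure q) (undecided q (?m r) r T \<epsilon> a)"
        by (simp add: mult.left_commute)
    qed
  qed
qed

theorem mainTheorem2:
  fixes q :: nat
  assumes "q \<ge> 2"
  shows "(\<forall>r\<ge>1. \<forall>T. tribes_partition (tribes_m q r) r T \<longrightarrow>
            symmetric_fun q (tribes_n q r) (gen_tribes q (tribes_m q r) T) \<and>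
            monotone_fun q (tribes_n q r) (gen_tribes q (tribes_m q r) T)) \<and>
         (\<exists>c C :: real. 0 < c \<and> c \<le> C \<and>
            (\<forall>\<epsilon> :: real. 0 < \<epsilon> \<and> \<epsilon> < 1 / 2 \<longrightarrow>
              (\<exists>r0\<ge>1. \<forall>r\<ge>r0. \<forall>T. tribes_partition (tribes_m q r) r T \<longrightarrow>
                (\<forall>a<q.
                  let \<gamma> = measure (simplex_measure q)
                        {\<mu> \<in> prob_simplex q.
                           \<epsilon> \<le> \<P>(x in product_dist q (tribes_n q r) \<mu>. gen_tribes q (tribes_m q r) T x = a) \<and>
                           \<P>(x in product_dist q (tribes_n q r) \<mu>. gen_tribes q (tribes_m q r) T x = a) \<le> 1 - \<epsilon>}
                  in c * (log 2 ((1 - \<epsilon>) / \<epsilon>) / log 2 (real (tribes_n q r))) \<le> \<gamma> \<and>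
                     \<gamma> \<le> C * (log 2 ((1 - \<epsilon>) / \<epsilon>) / log 2 (real (tribes_n q r)))))))"
proof (intro conjI allI impI)
  fix r T assume r: "1 \<le> r" and part: "tribes_partition (tribes_m q r) r T"
  show "symmetric_fun q (tribes_n q r) (gen_tribes q (tribes_m q r) T)"
    by (rule symmetric_gen_tribes[OF part r]) (simp add: tribes_n_def)
  show "monotone_fun q (tribes_n q r) (gen_tribes q (tribes_m q r) T)"
    by (rule monotone_gen_tribes) (use assms part in \<open>auto simp: tribes_partition_def tribes_n_def\<close>)
next
  let ?\<rho> = "tribes_rho q"
  define \<kappa> where "\<kappa> = - ln ?\<rho>"
  define c0 where "c0 = (1 / (4 * real q * (real q + 1))) ^ (q - 2) * ?\<rho> / 4"
  define C0 where "C0 = 8 * real q * fact (q - 1) * ?\<rho>"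
  note \<rho> = tribes_rho_bounds[OF assms]
  have pos: "0 < \<kappa>" "0 < c0" "0 < C0"
    using \<rho> assms by (auto simp: \<kappa>_def c0_def C0_def)
  \<comment> \<open>As \<open>ln n\<close> is asymptotic to \<open>\<kappa> r\<close>, factors of 2 absorb the error terms below.\<close>
  define c where "c = c0 * \<kappa> / 4"
  define C where "C = 4 * C0 * \<kappa> + c"
  have "0 < c" "c \<le> C" using pos by (auto simp: c_def C_def)
  moreover have "\<exists>r0\<ge>1. \<forall>r\<ge>r0. \<forall>T. tribes_partition (tribes_m q r) r T \<longrightarrow> (\<forall>a<q.
      let \<gamma> = measure (simplex_measure q)
            {\<mu> \<in> prob_simplex q.
               \<epsilon> \<le> \<P>(x in product_dist q (tribes_n q r) \<mu>. gen_tribes q (tribes_m q r) T x = a) \<and>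
               \<P>(x in product_dist q (tribes_n q r) \<mu>. gen_tribes q (tribes_m q r) T x = a) \<le> 1 - \<epsilon>}
      in c * (log 2 ((1 - \<epsilon>) / \<epsilon>) / log 2 (real (tribes_n q r))) \<le> \<gamma> \<and>
         \<gamma> \<le> C * (log 2 ((1 - \<epsilon>) / \<epsilon>) / log 2 (real (tribes_n q r))))"
    if \<epsilon>: "0 < \<epsilon> \<and> \<epsilon> < 1 / 2" for \<epsilon> :: real
  proof -
    define h where "h = ln ((1 - \<epsilon>) / \<epsilon>)"
    have h: "0 < h" using \<epsilon> by (simp add: h_def ln_gt_zero_iff field_simps)
    have "\<forall>\<^sub>F r in sequentially. \<forall>T. tribes_partition (tribes_m q r) r T \<longrightarrow> (\<forall>a<q.
        real r * measure (simplex_measure q) (undecided q (tribes_m q r) r T \<epsilon> a) \<le> 2 * C0 * h)"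
      by (rule undecided_upper) (use assms \<epsilon> pos \<rho> h in \<open>auto simp: C0_def h_def[symmetric]\<close>)
    moreover have "\<forall>\<^sub>F r in sequentially. \<forall>T. tribes_partition (tribes_m q r) r T \<longrightarrow> (\<forall>a<q.
        c0 * h / 2 \<le> real r * measure (simplex_measure q) (undecided q (tribes_m q r) r T \<epsilon> a))"
      by (rule undecided_lower) (use assms \<epsilon> pos \<rho> h in \<open>auto simp: c0_def h_def[symmetric]\<close>)
    moreover have "\<forall>\<^sub>F r in sequentially. \<kappa> / 2 < ln (real (tribes_n q r)) / real r"
      by (rule order_tendstoD(1)[OF ln_tribes_n_tendsto[OF assms]]) (use pos in \<open>simp add: \<kappa>_def\<close>)
    moreover have "\<forall>\<^sub>F r in sequentially. ln (real (tribes_n q r)) / real r < 2 * \<kappa>"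
      by (rule order_tendstoD(2)[OF ln_tribes_n_tendsto[OF assms]]) (use pos in \<open>simp add: \<kappa>_def\<close>)
    ultimately have "\<forall>\<^sub>F r in sequentially. \<forall>T. tribes_partition (tribes_m q r) r T \<longrightarrow> (\<forall>a<q.
      let \<gamma> = measure (simplex_measure q) (undecided q (tribes_m q r) r T \<epsilon> a)
      in c * (log 2 ((1 - \<epsilon>) / \<epsilon>) / log 2 (real (tribes_n q r))) \<le> \<gamma> \<and>
         \<gamma> \<le> C * (log 2 ((1 - \<epsilon>) / \<epsilon>) / log 2 (real (tribes_n q r))))"
      using eventually_ge_at_top[of 1]
    proof eventually_elim
      case (elim r)
      show ?case
      proof (intro allI impI)
        fix T a assume part: "tribes_partition (tribes_m q r) r T" and a: "a < q"
        let ?g = "measure (simplex_measure q) (undecided q (tribes_m q r) r T \<epsilon> a)"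
        let ?n = "ln (real (tribes_n q r))"
        have r: "0 < real r" using elim by simp
        have g: "c0 * h / 2 \<le> real r * ?g" "real r * ?g \<le> 2 * C0 * h"
          using elim(1,2) part a by auto
        have n: "\<kappa> / 2 * real r < ?n" "?n < 2 * \<kappa> * real r"
          using elim(3,4) r by (simp_all add: field_simps)
        have n0: "0 < ?n"
        proof -
          have "0 < \<kappa> / 2 * real r" using pos r by simp
          with n show ?thesis by linarith
        qed
        have D: "log 2 ((1 - \<epsilon>) / \<epsilon>) / log 2 (real (tribes_n q r)) = h / ?n"
          by (simp add: log_def h_def)
        have "c * h \<le> ?g * ?n"
        proof -
          have "c0 * h / 2 * (\<kappa> / 2) \<le> (real r * ?g) * (\<kappa> / 2)"
            using g(1) pos by (intro mult_right_mono) auto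
          also have "\<dots> = ?g * (\<kappa> / 2 * real r)" by simp
          also have "\<dots> \<le> ?g * ?n" using n(1) by (intro mult_left_mono) auto
          finally show ?thesis by (simp add: c_def mult_ac)
        qed
        moreover have "?g * ?n \<le> C * h"
        proof -
          have "?g * ?n \<le> ?g * (2 * \<kappa> * real r)" using n(2) by (intro mult_left_mono) auto
          also have "\<dots> = (real r * ?g) * (2 * \<kappa>)" by simp
          also have "\<dots> \<le> 2 * C0 * h * (2 * \<kappa>)" using g(2) pos by (intro mult_right_mono) auto
          also have "\<dots> \<le> C * h" using \<open>0 < c\<close> h by (simp add: C_def algebra_simps)
          finally show ?thesis .
        qed
        ultimately have "c * (h / ?n) \<le> ?g" "?g \<le> C * (h / ?n)"
          using n0 by (simp_all add: field_simps)
        then show "let \<gamma> = ?g in c * (log 2 ((1 - \<epsilon>) / \<epsilon>) / log 2 (real (tribes_n q r))) \<le> \<gamma> \<and>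
            \<gamma> \<le> C * (log 2 ((1 - \<epsilon>) / \<epsilon>) / log 2 (real (tribes_n q r)))"
          unfolding D Let_def by blast
      qed
    qed
    then obtain r1 where r1: "\<And>r. r \<ge> r1 \<Longrightarrow> \<forall>T. tribes_partition (tribes_m q r) r T \<longrightarrow> (\<forall>a<q.
      let \<gamma> = measure (simplex_measure q) (undecided q (tribes_m q r) r T \<epsilon> a)
      in c * (log 2 ((1 - \<epsilon>) / \<epsilon>) / log 2 (real (tribes_n q r))) \<le> \<gamma> \<and>
         \<gamma> \<le> C * (log 2 ((1 - \<epsilon>) / \<epsilon>) / log 2 (real (tribes_n q r))))"
      unfolding eventually_sequentially by blast
    have "undecided q (tribes_m q r) r T \<epsilon> a = {\<mu> \<in> prob_simplex q.
        \<epsilon> \<le> \<P>(x in product_dist q (tribes_n q r) \<mu>. gen_tribes q (tribes_m q r) T x = a) \<and>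
        \<P>(x in product_dist q (tribes_n q r) \<mu>. gen_tribes q (tribes_m q r) T x = a) \<le> 1 - \<epsilon>}" for r T a
      unfolding undecided_def by (auto simp: prob_product_dist tribes_prob_def tribes_n_def)
    with r1 show ?thesis by (intro exI[of _ "max 1 r1"]) auto
  qed
  ultimately show "\<exists>c C :: real. 0 < c \<and> c \<le> C \<and>
            (\<forall>\<epsilon> :: real. 0 < \<epsilon> \<and> \<epsilon> < 1 / 2 \<longrightarrow>
              (\<exists>r0\<ge>1. \<forall>r\<ge>r0. \<forall>T. tribes_partition (tribes_m q r) r T \<longrightarrow>
                (\<forall>a<q.
                  let \<gamma> = measure (simplex_measure q)
                        {\<mu> \<in> prob_simplex q.
                           \<epsilon> \<le> \<P>(x in product_dist q (tribes_n q r) \<mu>. gen_tribes q (tribes_m q r) T x = a) \<and>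
                           \<P>(x in product_dist q (tribes_n q r) \<mu>. gen_tribes q (tribes_m q r) T x = a) \<le> 1 - \<epsilon>}
                  in c * (log 2 ((1 - \<epsilon>) / \<epsilon>) / log 2 (real (tribes_n q r))) \<le> \<gamma> \<and>
                     \<gamma> \<le> C * (log 2 ((1 - \<epsilon>) / \<epsilon>) / log 2 (real (tribes_n q r))))))"
    by (intro exI[of _ c] exI[of _ C] conjI allI impI)
qed

end
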